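(* Let $k\ge1$ and let $M\subseteq\mathbb{N}^k$ be an infinite set definable in $(\mathbb{N},+)$. Then there is a unique natural number $l$ such that there exists a bijection between $M$ and $\mathbb{N}^l$ definable in $(\mathbb{N},+)$; moreover $1\le l\le k$.
   Context: Definable means first-order definable in $(\mathbb{N},+)$ without parameters (a bijection is definable if its graph is). *)

theory Defs
  imports Main
begin

text \<open>First-order logic with equality over the signature with one binary function symbol,
  interpreted as addition on the natural numbers (with 0).  There are no constant symbols for
  numbers, hence no parameters.\<close>

datatype tm = Var nat | Plus tm tm

datatype fm = Eq tm tm | Neg fm | Conj fm fm | Exists nat fm

primrec tm_val :: "(nat \<Rightarrow> nat) \<Rightarrow> tm \<Rightarrow> nat" where
  "tm_val e (Var x) = e x"
| "tm_val e (Plus s t) = tm_val e s + tm_val e t"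

primrec sat :: "(nat \<Rightarrow> nat) \<Rightarrow> fm \<Rightarrow> bool" where
  "sat e (Eq s t) \<longleftrightarrow> tm_val e s = tm_val e t"
| "sat e (Neg p) \<longleftrightarrow> \<not> sat e p"
| "sat e (Conj p q) \<longleftrightarrow> sat e p \<and> sat e q"
| "sat e (Exists x p) \<longleftrightarrow> (\<exists>a. sat (e(x := a)) p)"

primrec tm_vars :: "tm \<Rightarrow> nat set" where
  "tm_vars (Var x) = {x}"
| "tm_vars (Plus s t) = tm_vars s \<union> tm_vars t"

primrec free_vars :: "fm \<Rightarrow> nat set" where
  "free_vars (Eq s t) = tm_vars s \<union> tm_vars t"
| "free_vars (Neg p) = free_vars p"
| "free_vars (Conj p q) = free_vars p \<union> free_vars q"
| "free_vars (Exists x p) = free_vars p - {x}"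

definition tuples :: "nat \<Rightarrow> nat list set" where
  "tuples k = {xs. length xs = k}"

text \<open>The value 0 given to variables from \<^term>\<open>length xs\<close> on is irrelevant:
  below, the free variables of the formula are required to be smaller.\<close>

definition assign :: "nat list \<Rightarrow> nat \<Rightarrow> nat" where
  "assign xs i = (if i < length xs then xs ! i else 0)"

definition definable :: "nat \<Rightarrow> nat list set \<Rightarrow> bool" where
  "definable k M \<longleftrightarrow>
     (\<exists>p. free_vars p \<subseteq> {..<k} \<and> M = {xs \<in> tuples k. sat (assign xs) p})"

definition graph_on :: "nat list set \<Rightarrow> (nat list \<Rightarrow> nat list) \<Rightarrow> nat list set" where
  "graph_on M f = (\<lambda>xs. xs @ f xs) ` M"

text \<open>For \<open>M \<subseteq> tuples k\<close>, the graph of a map into \<open>tuples l\<close> is a subset of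
  \<open>tuples (k + l)\<close>; concatenation of a pair of tuples loses no information because
  \<open>k\<close> is fixed.\<close>

definition definable_bij :: "nat \<Rightarrow> nat \<Rightarrow> (nat list \<Rightarrow> nat list) \<Rightarrow> nat list set \<Rightarrow> bool" where
  "definable_bij k l f M \<longleftrightarrow>
     bij_betw f M (tuples l) \<and> definable (k + l) (graph_on M f)"

end

theory Submission
  imports Defs "HOL-Library.Multiset"
begin

text \<open>Definable sets are described by finitely many signs of affine functions and residues
  (quantifier elimination by a back-and-forth argument).  By Dickson's lemma each cell of such a
  description has the form \<open>B + \<langle>P\<rangle>\<close> with \<open>B\<close> finite and one common finite set \<open>P\<close> of periods.
  Since \<open>P\<close> is common, the lexicographically least representations form downsets of
  \<open>\<nat>\<^sup>d\<close>, and a downset is a disjoint union of translated coordinate orthants.  So a definable set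
  is a disjoint union of injective affine images of some \<open>\<nat>\<^sup>d\<close>, that is, it is tiled by a multiset
  of dimensions.

  A tile of dimension \<open>d > 0\<close> splits into dimensions \<open>d, d\<close> (by parity of one coordinate) or
  \<open>d, d - 1\<close> (by whether this coordinate vanishes).  With these two moves any tiling of maximal
  dimension \<open>l > 0\<close> and the trivial tiling of \<open>\<nat>\<^sup>l\<close> reach a common multiset, and matching tiles
  gives a bijection with a semilinear, hence definable, graph.

  Conversely, a definable bijection and its inverse have linear growth, since their graphs are
  semilinear, so counting the points of large boxes shows that the dimension is unique and is at
  most \<open>k\<close>.\<close>

section \<open>Quantifier elimination\<close>

text \<open>Values in \<open>int\<close> admit negative coefficients, so differences of terms,
  thresholds and negated conditions stay in the class.\<close>

inductive affine :: "((nat \<Rightarrow> nat) \<Rightarrow> int) \<Rightarrow> bool" where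
  affine_const: "affine (\<lambda>e. c)"
| affine_var: "affine (\<lambda>e. int (e x))"
| affine_add: "affine \<alpha> \<Longrightarrow> affine \<beta> \<Longrightarrow> affine (\<lambda>e. \<alpha> e + \<beta> e)"
| affine_scale: "affine \<alpha> \<Longrightarrow> affine (\<lambda>e. c * \<alpha> e)"

lemma affine_diff: "affine \<alpha> \<Longrightarrow> affine \<beta> \<Longrightarrow> affine (\<lambda>e. \<alpha> e - \<beta> e)"
  using affine_add[OF _ affine_scale[of \<beta> "-1"], of \<alpha>] by simp

lemma affine_tm_val: "affine (\<lambda>e. int (tm_val e t))"
  by (induction t) (auto intro: affine.intros)

text \<open>Splits off the coefficient of the quantified variable. The left side ignores
  \<open>e x\<close>, hence so does \<beta>.\<close>

lemma affine_fun_upd: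
  "affine \<alpha> \<Longrightarrow> \<exists>c \<beta>. affine \<beta> \<and> (\<forall>e a. \<alpha> (e(x := a)) = c * int a + \<beta> e)"
proof (induction rule: affine.induct)
  case (affine_const c)
  then show ?case by (intro exI[of _ 0] exI[of _ "\<lambda>e. c"]) (auto intro: affine.intros)
next
  case (affine_var y)
  show ?case
  proof (cases "y = x")
    case True
    then show ?thesis by (intro exI[of _ 1] exI[of _ "\<lambda>e. 0"]) (auto intro: affine.intros)
  next
    case False
    then show ?thesis by (intro exI[of _ 0] exI[of _ "\<lambda>e. int (e y)"]) (auto intro: affine.intros)
  qed
next
  case (affine_add \<alpha> \<beta>)
  then obtain c1 b1 c2 b2 where "affine b1" "affine b2"
    "\<forall>e a. \<alpha> (e(x := a)) = c1 * int a + b1 e" "\<forall>e a. \<beta> (e(x := a)) = c2 * int a + b2 e"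
    by blast
  then show ?case
    by (intro exI[of _ "c1 + c2"] exI[of _ "\<lambda>e. b1 e + b2 e"])
      (simp add: affine.affine_add algebra_simps del: fun_upd_apply)
next
  case (affine_scale \<alpha> c)
  then obtain c1 b1 where "affine b1" "\<forall>e a. \<alpha> (e(x := a)) = c1 * int a + b1 e"
    by blast
  then show ?case
    by (intro exI[of _ "c * c1"] exI[of _ "\<lambda>e. c * b1 e"])
      (simp add: affine.affine_scale algebra_simps del: fun_upd_apply)
qed

lemma affine_mod_cong:
  assumes "affine \<alpha>" "\<And>i. e i mod N = e' i mod N"
  shows "\<alpha> e mod int N = \<alpha> e' mod int N"
  using assms(1)
proof (induction rule: affine.induct)
  case (affine_var x)
  then show ?case using assms(2)[of x] by (simp flip: zmod_int)
next
  case (affine_add \<alpha> \<beta>)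
  then show ?case by (metis mod_add_eq)
next
  case (affine_scale \<alpha> c)
  then show ?case by (metis mod_mult_right_eq)
qed simp

text \<open>Additivity of the linear part of \<alpha>, with the constant term
  \<open>\<alpha> (\<lambda>i. 0)\<close> moved across instead of subtracted.\<close>

lemma affine_plus:
  assumes "affine \<alpha>"
  shows "\<alpha> (\<lambda>i. u i + v i) + \<alpha> (\<lambda>i. 0) = \<alpha> u + \<alpha> v"
  using assms
proof induction
  case (affine_scale \<alpha> c)
  then show ?case by (metis distrib_left)
qed simp_all

text \<open>Equality of quantifier-free types relative to \<open>A\<close> and \<open>N\<close>.
  Residues are compared at all variables at once, which avoids tracking free variables through the
  induction on formulas.\<close>

definition indist :: "((nat \<Rightarrow> nat) \<Rightarrow> int) set \<Rightarrow> nat \<Rightarrow> (nat \<Rightarrow> nat) \<Rightarrow> (nat \<Rightarrow> nat) \<Rightarrow> bool" where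
  "indist A N e e' \<longleftrightarrow> (\<forall>\<alpha>\<in>A. 0 \<le> \<alpha> e \<longleftrightarrow> 0 \<le> \<alpha> e') \<and> (\<forall>i. e i mod N = e' i mod N)"

lemma indist_sym: "indist A N e e' \<Longrightarrow> indist A N e' e"
  by (auto simp: indist_def)

lemma indist_Un_mult:
  assumes "indist (A \<union> A') (N * N') e e'"
  shows "indist A N e e'" "indist A' N' e e'"
  using assms unfolding indist_def by (auto, (metis mod_mult_right_eq mod_mod_cancel dvd_triv_left dvd_triv_right)+)

text \<open>Multiplying by suitable positive integers gives all affine functions that depend on \<open>x\<close> the
  same coefficient \<open>\<plusminus>L\<close> at \<open>x\<close>; their signs then only compare \<open>L * x\<close> with thresholds not involving \<open>x\<close>.\<close>
lemma common_thresholds: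
  assumes "finite A" "\<forall>\<alpha>\<in>A. affine \<alpha>"
  shows "\<exists>L T A0. L > (0::nat) \<and> finite T \<and> finite A0 \<and> (\<forall>\<alpha>\<in>T \<union> A0. affine \<alpha>) \<and>
    (\<forall>e e' a a'. (\<forall>\<alpha>\<in>A0. 0 \<le> \<alpha> e \<longleftrightarrow> 0 \<le> \<alpha> e') \<and>
      (\<forall>\<tau>\<in>T. \<tau> e \<le> int L * int a \<longleftrightarrow> \<tau> e' \<le> int L * int a') \<longrightarrow>
      (\<forall>\<alpha>\<in>A. 0 \<le> \<alpha> (e(x := a)) \<longleftrightarrow> 0 \<le> \<alpha> (e'(x := a'))))"
  using assms
proof (induction rule: finite_induct)
  case empty
  show ?case by (intro exI[of _ 1] exI[of _ "{}"]) auto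
next
  case (insert \<alpha> A)
  then have "\<forall>\<alpha>\<in>A. affine \<alpha>" by simp
  from insert.IH[OF this]
  obtain L T A0 where LT: "L > 0" "finite T" "finite A0" "\<forall>\<alpha>\<in>T \<union> A0. affine \<alpha>"
    and *: "\<forall>e e' a a'. (\<forall>\<alpha>\<in>A0. 0 \<le> \<alpha> e \<longleftrightarrow> 0 \<le> \<alpha> e') \<and>
      (\<forall>\<tau>\<in>T. \<tau> e \<le> int L * int a \<longleftrightarrow> \<tau> e' \<le> int L * int a') \<longrightarrow>
      (\<forall>\<alpha>\<in>A. 0 \<le> \<alpha> (e(x := a)) \<longleftrightarrow> 0 \<le> \<alpha> (e'(x := a')))"
    by (elim exE conjE) (rule that)
  obtain c \<beta> where c: "affine \<beta>" "\<And>e a. \<alpha> (e(x := a)) = c * int a + \<beta> e"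
    using affine_fun_upd[of \<alpha> x] insert.prems by auto
  show ?case
  proof (cases "c = 0")
    case True
    show ?thesis
      by (rule exI[of _ L], rule exI[of _ T], rule exI[of _ "insert \<beta> A0"])
        (use LT c True * in \<open>auto simp del: fun_upd_apply\<close>)
  next
    case False
    \<comment> \<open>For \<open>c < 0\<close> the condition is an upper bound on
      \<open>L * \<bar>c\<bar> * a\<close>. It is the negation of the lower bound with threshold one
      larger, hence the \<open>+ 1\<close>.\<close>
    define \<tau> where "\<tau> = (\<lambda>e. if c > 0 then - int L * \<beta> e else int L * \<beta> e + 1)"
    define L' where "L' = L * nat \<bar>c\<bar>"
    define T' where "T' = insert \<tau> ((\<lambda>\<tau> e. \<bar>c\<bar> * \<tau> e) ` T)"
    have "affine \<tau>" unfolding \<tau>_def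
      using affine_scale[OF c(1), of "int L"] affine_scale[OF c(1), of "- int L"] affine_const
        affine_add by (cases "c > 0") auto
    have aff: "\<forall>\<alpha>\<in>T' \<union> A0. affine \<alpha>"
      using LT(4) \<open>affine \<tau>\<close> affine_scale unfolding T'_def by blast
    have sgn\<alpha>: "0 \<le> \<alpha> (e(x := a)) \<longleftrightarrow> (if c > 0 then \<tau> e \<le> int L' * int a else \<not> \<tau> e \<le> int L' * int a)"
      for e a
    proof -
      have "0 \<le> c * int a + \<beta> e \<longleftrightarrow> 0 \<le> int L * (c * int a + \<beta> e)"
        using LT(1) by (simp add: zero_le_mult_iff)
      also have "\<dots> \<longleftrightarrow> (if c > 0 then \<tau> e \<le> int L' * int a else \<not> \<tau> e \<le> int L' * int a)"
        using False unfolding \<tau>_def L'_def by (auto simp: algebra_simps)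
      finally show ?thesis using c(2) by simp
    qed
    have scale: "\<bar>c\<bar> * t \<le> int L' * int a \<longleftrightarrow> t \<le> int L * int a" for t a
    proof -
      have "\<bar>c\<bar> * t \<le> \<bar>c\<bar> * (int L * int a) \<longleftrightarrow> t \<le> int L * int a"
        using False by (subst mult_le_cancel_left_pos) auto
      then show ?thesis by (simp add: L'_def mult.assoc mult.left_commute)
    qed
    show ?thesis
    proof (rule exI[of _ L'], rule exI[of _ T'], rule exI[of _ A0], intro conjI allI impI)
      fix e e' a a'
      assume h: "(\<forall>\<alpha>\<in>A0. (0 \<le> \<alpha> e) = (0 \<le> \<alpha> e')) \<and>
        (\<forall>\<tau>\<in>T'. (\<tau> e \<le> int L' * int a) = (\<tau> e' \<le> int L' * int a'))"
      then have "\<forall>\<tau>\<in>T. (\<tau> e \<le> int L * int a) = (\<tau> e' \<le> int L * int a')"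
        unfolding T'_def by (simp add: scale)
      moreover have "(\<tau> e \<le> int L' * int a) = (\<tau> e' \<le> int L' * int a')"
        using h unfolding T'_def by blast
      ultimately show "\<forall>\<alpha>\<in>insert \<alpha> A. (0 \<le> \<alpha> (e(x := a))) = (0 \<le> \<alpha> (e'(x := a')))"
        using *[rule_format, of e e' a a'] h sgn\<alpha> by auto
    qed (use LT False aff in \<open>auto simp: L'_def T'_def\<close>)
  qed
qed

text \<open>Given \<open>a\<close>, the answer \<open>a'\<close> keeps the distance of \<open>L * a\<close> to the largest threshold below it,
  reduced modulo \<open>N * L\<close>.\<close>
lemma indist_back_and_forth:
  assumes "finite A" "\<forall>\<alpha>\<in>A. affine \<alpha>" "N > 0"
  obtains A' N' where "finite A'" "\<And>\<alpha>. \<alpha> \<in> A' \<Longrightarrow> affine \<alpha>" "N' > 0"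
    "\<And>e e' a. indist A' N' e e' \<Longrightarrow> \<exists>a'. indist A N (e(x := a)) (e'(x := a'))"
proof -
  from common_thresholds[OF assms(1,2), of x]
  obtain L T A0 where LT: "L > 0" "finite T" "finite A0" "\<forall>\<alpha>\<in>T \<union> A0. affine \<alpha>"
    and *: "\<forall>e e' a a'. (\<forall>\<alpha>\<in>A0. 0 \<le> \<alpha> e \<longleftrightarrow> 0 \<le> \<alpha> e') \<and>
      (\<forall>\<tau>\<in>T. \<tau> e \<le> int L * int a \<longleftrightarrow> \<tau> e' \<le> int L * int a') \<longrightarrow>
      (\<forall>\<alpha>\<in>A. 0 \<le> \<alpha> (e(x := a)) \<longleftrightarrow> 0 \<le> \<alpha> (e'(x := a')))"
    by (elim exE conjE) (rule that)
  \<comment> \<open>The zero threshold ensures that some threshold lies below \<open>L * a\<close>,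
    and that the answer is nonnegative.\<close>
  define T' where "T' = insert (\<lambda>e. 0) T"
  \<comment> \<open>These signs record the order of the thresholds (\<open>d = 0\<close>) and their
    mutual distances up to \<open>N * L\<close>.\<close>
  define A' where "A' = A0 \<union> (\<lambda>(\<tau>, \<sigma>, d) e. \<tau> e - \<sigma> e - int d) ` (T' \<times> T' \<times> {..N * L})"
  have aff: "affine \<tau>" if "\<tau> \<in> T'" for \<tau>
    using that LT(4) unfolding T'_def by (auto intro: affine.intros)
  show thesis
  proof (rule that[of A' "N * L"])
    show "finite A'" unfolding A'_def T'_def using LT by auto
    show "affine \<alpha>" if "\<alpha> \<in> A'" for \<alpha>
      using that LT(4) aff unfolding A'_def by (auto intro!: affine_diff affine_const)
    show "N * L > 0" using LT assms by simp
    fix e e' a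
    assume ind: "indist A' (N * L) e e'"
    have sgnd: "0 \<le> \<tau> e - \<sigma> e - int d \<longleftrightarrow> 0 \<le> \<tau> e' - \<sigma> e' - int d"
      if "\<tau> \<in> T'" "\<sigma> \<in> T'" "d \<le> N * L" for \<tau> \<sigma> d
    proof -
      have "(\<lambda>e. \<tau> e - \<sigma> e - int d) \<in> A'"
        unfolding A'_def using that by (intro UnI2 image_eqI[of _ _ "(\<tau>, \<sigma>, d)"]) auto
      from ind[unfolded indist_def, THEN conjunct1, rule_format, OF this] show ?thesis .
    qed
    define s where "s = int L * int a"
    define S where "S = {\<tau>\<in>T'. \<tau> e \<le> s}"
    have "finite S" "(\<lambda>e. 0) \<in> S" unfolding S_def T'_def s_def using LT by auto
    then have "Max ((\<lambda>\<tau>. \<tau> e) ` S) \<in> (\<lambda>\<tau>. \<tau> e) ` S" by (intro Max_in) auto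
    then obtain t where t: "t \<in> S" "Max ((\<lambda>\<tau>. \<tau> e) ` S) = t e" by auto
    have tmax: "\<tau> e \<le> t e" if "\<tau> \<in> S" for \<tau>
      using that \<open>finite S\<close> t(2)[symmetric] by auto
    have tT: "t \<in> T'" "t e \<le> s" using t(1) by (auto simp: S_def)
    define d where "d = nat ((s - t e) mod int (N * L))"
    have pos: "int (N * L) > 0" using LT(1) assms(3) by simp
    have d: "int d = (s - t e) mod int (N * L)" using pos by (simp add: d_def)
    have "int d < int (N * L)" using pos unfolding d by (rule pos_mod_bound)
    then have dlt: "d < N * L" by (simp only: of_nat_less_iff)
    have dle: "t e + int d \<le> s" using tT(2) d pos zmod_le_nonneg_dividend[of "s - t e" "int (N * L)"] by linarith
    define s' where "s' = t e' + int d"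
    have pos_iff: "\<tau> e \<le> s \<longleftrightarrow> \<tau> e' \<le> s'" if "\<tau> \<in> T'" for \<tau>
    proof (cases "\<tau> e \<le> s")
      case True
      then have "\<tau> e \<le> t e" using that tmax by (simp add: S_def)
      then have "\<tau> e' \<le> t e'" using sgnd[OF tT(1) that, of 0] by simp
      then show ?thesis using True by (simp add: s'_def)
    next
      case False
      \<comment> \<open>A threshold above \<open>s\<close> is more than \<open>d\<close> above
        \<open>t\<close>. As \<open>d < N * L\<close>, the distance \<open>Suc d\<close> is still
        among those recorded in \<open>A'\<close>.\<close>
      then have "0 \<le> \<tau> e - t e - int (Suc d)" using dle by simp
      then have "0 \<le> \<tau> e' - t e' - int (Suc d)" using sgnd[OF that tT(1), of "Suc d"] dlt by simp
      then show ?thesis using False by (simp add: s'_def)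
    qed
    have "s' \<ge> 0" using pos_iff[of "\<lambda>e. 0"] by (simp add: T'_def s_def)
    have em: "e i mod (N * L) = e' i mod (N * L)" for i
      using ind by (simp add: indist_def)
    \<comment> \<open>The congruence modulo \<open>N * L\<close> serves twice: \<open>L\<close>
      divides \<open>s'\<close>, which yields \<open>a'\<close>, and after division by
      \<open>L\<close> the residue of \<open>a'\<close> modulo \<open>N\<close> is that of
      \<open>a\<close>.\<close>
    have "s' mod int (N * L) = (t e + int d) mod int (N * L)"
      unfolding s'_def using affine_mod_cong[OF aff[OF tT(1)], of e "N * L" e'] em
      by (metis mod_add_left_eq)
    also have "\<dots> = s mod int (N * L)" unfolding d by (simp add: mod_add_right_eq)
    finally have "int (N * L) dvd s' - s" by (simp add: mod_eq_dvd_iff)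
    then have dv: "int N * int L dvd s' - int L * int a" by (simp add: s_def)
    have "int L dvd (s' - int L * int a) + int L * int a"
      using dvd_mult_right[OF dv] by (intro dvd_add) auto
    then have "int L dvd s'" by simp
    then obtain q where q: "s' = int L * q" by blast
    have "q \<ge> 0" using q \<open>s' \<ge> 0\<close> LT(1) by (simp add: zero_le_mult_iff)
    define a' where "a' = nat q"
    have a': "s' = int L * int a'" using q \<open>q \<ge> 0\<close> by (simp add: a'_def)
    have "int L * int N dvd int L * (int a' - int a)"
      using dv by (simp add: a' algebra_simps)
    then have "int N dvd int a' - int a" using LT(1) by (subst (asm) dvd_mult_cancel_left) auto
    then have "a mod N = a' mod N" by (simp add: mod_eq_dvd_iff[symmetric] flip: zmod_int)
    moreover have "e i mod N = e' i mod N" for i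
      using em[of i] by (metis dvd_triv_left mod_mod_cancel)
    moreover have "\<forall>\<alpha>\<in>A. 0 \<le> \<alpha> (e(x := a)) \<longleftrightarrow> 0 \<le> \<alpha> (e'(x := a'))"
      using *[rule_format, of e e' a a'] ind pos_iff unfolding indist_def A'_def T'_def s_def a' by auto
    ultimately show "\<exists>a'. indist A N (e(x := a)) (e'(x := a'))"
      unfolding indist_def by (intro exI[of _ a']) auto
  qed
qed

text \<open>Quantifier elimination in semantic form: no quantifier-free formula is built, truth is
  only shown to be invariant under \<open>indist\<close>. In the case of \<open>Exists\<close>,
  symmetry of \<open>indist\<close> turns the one-sided back-and-forth step into an
  equivalence.\<close>

lemma sat_determined:
  "\<exists>A N. finite A \<and> (\<forall>\<alpha>\<in>A. affine \<alpha>) \<and> N > 0 \<and> (\<forall>e e'. indist A N e e' \<longrightarrow> sat e p = sat e' p)"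
proof (induction p)
  case (Eq s t)
  let ?A = "{\<lambda>e. int (tm_val e s) - int (tm_val e t), \<lambda>e. int (tm_val e t) - int (tm_val e s)}"
  show ?case
    by (rule exI[of _ ?A], rule exI[of _ 1])
      (auto simp: indist_def intro: affine_diff affine_tm_val)
next
  case (Neg p)
  then show ?case by auto
next
  case (Conj p q)
  then obtain A N A' N' where "finite A" "\<forall>\<alpha>\<in>A. affine \<alpha>" "N > 0" "finite A'" "\<forall>\<alpha>\<in>A'. affine \<alpha>" "N' > 0"
    "\<And>e e'. indist A N e e' \<Longrightarrow> sat e p = sat e' p" "\<And>e e'. indist A' N' e e' \<Longrightarrow> sat e q = sat e' q"
    by blast
  then show ?case
    by (intro exI[of _ "A \<union> A'"] exI[of _ "N * N'"]) (auto dest: indist_Un_mult)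
next
  case (Exists x p)
  then obtain A N where AN: "finite A" "\<forall>\<alpha>\<in>A. affine \<alpha>" "N > 0"
    "\<And>e e'. indist A N e e' \<Longrightarrow> sat e p = sat e' p"
    by blast
  obtain A' N' where "finite A'" "\<And>\<alpha>. \<alpha> \<in> A' \<Longrightarrow> affine \<alpha>" "N' > 0"
    and bf: "\<And>e e' a. indist A' N' e e' \<Longrightarrow> \<exists>a'. indist A N (e(x := a)) (e'(x := a'))"
    using indist_back_and_forth[OF AN(1-3)] by metis
  moreover have "sat e (Exists x p) = sat e' (Exists x p)" if "indist A' N' e e'" for e e'
    using bf[OF that] bf[OF indist_sym[OF that]] AN(4) by simp metis
  ultimately show ?case by blast
qed

section \<open>Dickson's lemma and tilings\<close>

text \<open>Stated for any finite family of functions, so that coordinates and values of affine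
  functions can be compared together. In the induction, \<open>B\<close> serves the old functions
  and \<open>m\<close> bounds \<open>f\<close> on \<open>B\<close>: points with
  \<open>f a \<ge> m\<close> are dominated from \<open>B\<close>, and each of the finitely many
  slices \<open>f a = t < m\<close> has its own finite set \<open>C t\<close>.\<close>

lemma dickson:
  fixes F :: "('a \<Rightarrow> nat) set"
  assumes "finite F"
  shows "\<exists>B. finite B \<and> B \<subseteq> A \<and> (\<forall>a\<in>A. \<exists>b\<in>B. \<forall>f\<in>F. f b \<le> f a)"
  using assms
proof (induction arbitrary: A rule: finite_induct)
  case empty
  show ?case
  proof (cases "A = {}")
    case False
    then obtain a where "a \<in> A" by blast
    then show ?thesis by (intro exI[of _ "{a}"]) simp
  qed simp
next
  case (insert f F)
  obtain B where B: "finite B" "B \<subseteq> A" "\<And>a. a \<in> A \<Longrightarrow> \<exists>b\<in>B. \<forall>f\<in>F. f b \<le> f a"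
    using insert.IH[of A] by (elim exE conjE) simp
  have "\<forall>t. \<exists>B. finite B \<and> B \<subseteq> {a \<in> A. f a = t} \<and>
      (\<forall>a\<in>{a \<in> A. f a = t}. \<exists>b\<in>B. \<forall>f\<in>F. f b \<le> f a)"
    using insert.IH by (rule allI)
  from choice[OF this] obtain C where "\<forall>t. finite (C t) \<and> C t \<subseteq> {a \<in> A. f a = t} \<and>
      (\<forall>a\<in>{a \<in> A. f a = t}. \<exists>b\<in>C t. \<forall>f\<in>F. f b \<le> f a)" ..
  then have C: "\<And>t. finite (C t)" "\<And>t. C t \<subseteq> {a \<in> A. f a = t}"
    "\<And>t a. a \<in> A \<Longrightarrow> f a = t \<Longrightarrow> \<exists>b\<in>C t. \<forall>f\<in>F. f b \<le> f a"
    by auto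
  obtain m where m: "\<And>b. b \<in> B \<Longrightarrow> f b \<le> m"
    using B(1) finite_nat_set_iff_bounded_le[of "f ` B"] by auto
  show ?case
  proof (intro exI[of _ "B \<union> (\<Union>t<m. C t)"] conjI ballI)
    fix a assume "a \<in> A"
    show "\<exists>b\<in>B \<union> (\<Union>t<m. C t). \<forall>g\<in>insert f F. g b \<le> g a"
    proof (cases "f a < m")
      case True
      obtain b where "b \<in> C (f a)" "\<forall>g\<in>F. g b \<le> g a" using C(3)[of a "f a"] \<open>a \<in> A\<close> by auto
      moreover from this have "f b = f a" using C(2) by blast
      ultimately show ?thesis using True by (intro bexI[of _ b]) auto
    next
      case False
      obtain b where "b \<in> B" "\<forall>g\<in>F. g b \<le> g a" using B(3) \<open>a \<in> A\<close> by blast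
      then show ?thesis using False m[of b] by (intro bexI[of _ b]) auto
    qed
  next
    show "B \<union> (\<Union>t<m. C t) \<subseteq> A" using B(2) C(2) by blast
  qed (use B(1) C(1) in auto)
qed

text \<open>A model of \<nat>^k by zero-padded functions, the shape that \<open>assign\<close>
  produces. All dimensions share one type.\<close>

definition vecs :: "nat \<Rightarrow> (nat \<Rightarrow> nat) set" where
  "vecs k = {v. \<forall>i\<ge>k. v i = 0}"

definition lin :: "(nat \<Rightarrow> nat) \<Rightarrow> (nat \<Rightarrow> nat \<Rightarrow> nat) \<Rightarrow> nat \<Rightarrow> (nat \<Rightarrow> nat) \<Rightarrow> nat \<Rightarrow> nat" where
  "lin b P d c = (\<lambda>i. b i + (\<Sum>j<d. c j * P j i))"

lemma zero_in_vecs [simp]: "(\<lambda>_. 0) \<in> vecs k"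
  by (simp add: vecs_def)

lemma finite_bounded_vecs: "finite {v \<in> vecs d. \<forall>i. v i \<le> T}"
  by (rule finite_subset[OF _ finite_set_of_finite_funs[of "{..<d}" "{..T}" 0]]) (auto simp: vecs_def)

lemma lin_in_vecs: "b \<in> vecs k \<Longrightarrow> (\<And>j. j < d \<Longrightarrow> P j \<in> vecs k) \<Longrightarrow> lin b P d c \<in> vecs k"
  by (auto simp: vecs_def lin_def)

lemma lin_add: "lin b P d (\<lambda>i. c i + c' i) i = lin b P d c i + (\<Sum>j<d. c' j * P j i)"
  by (simp add: lin_def algebra_simps sum.distrib)

lemma lin_lin: "lin b P d (lin b' P' d' c) = lin (lin b P d b') (\<lambda>m. lin (\<lambda>_. 0) P d (P' m)) d' c"
proof
  fix i
  have "(\<Sum>j<d. (\<Sum>m<d'. c m * P' m j) * P j i) = (\<Sum>m<d'. c m * (\<Sum>j<d. P' m j * P j i))"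
    by (simp add: sum_distrib_left sum_distrib_right mult.assoc) (rule sum.swap)
  then show "lin b P d (lin b' P' d' c) i = lin (lin b P d b') (\<lambda>m. lin (\<lambda>_. 0) P d (P' m)) d' c i"
    by (simp add: lin_def add_mult_distrib sum.distrib)
qed

text \<open>Injectivity means that the periods are linearly independent, so \<open>d\<close> is the
  true dimension.\<close>

definition simple_linear :: "nat \<Rightarrow> nat \<Rightarrow> (nat \<Rightarrow> nat) set \<Rightarrow> bool" where
  "simple_linear k d L \<longleftrightarrow> (\<exists>b P. b \<in> vecs k \<and> (\<forall>j<d. P j \<in> vecs k) \<and> inj_on (lin b P d) (vecs d) \<and>
     L = lin b P d ` vecs d)"

text \<open>Only the dimensions of the tiles are recorded, because two tiles of equal dimension are
  matched through their coefficient vectors.\<close>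

inductive tiled :: "nat \<Rightarrow> nat multiset \<Rightarrow> (nat \<Rightarrow> nat) set \<Rightarrow> bool" for k where
  tiled_empty: "tiled k {#} {}"
| tiled_insert: "tiled k D M \<Longrightarrow> simple_linear k d L \<Longrightarrow> L \<inter> M = {} \<Longrightarrow> tiled k (add_mset d D) (L \<union> M)"

lemma tiled_simple: "simple_linear k d L \<Longrightarrow> tiled k {#d#} L"
  using tiled_insert[OF tiled_empty, of k d L] by simp

lemma tiled_Un:
  assumes "tiled k D M" "tiled k E N" "M \<inter> N = {}"
  shows "tiled k (D + E) (M \<union> N)"
  using assms(1,3)
proof induction
  case tiled_empty
  then show ?case using assms(2) by simp
next
  case (tiled_insert D M d L)
  then have "tiled k (D + E) (M \<union> N)" by blast
  from tiled.tiled_insert[OF this, of d L] show ?case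
    using tiled_insert by (simp add: Un_assoc Int_Un_distrib Int_Un_distrib2)
qed

lemma tiled_UN:
  assumes "finite I" "\<And>i. i \<in> I \<Longrightarrow> \<exists>D. tiled k D (S i)"
    "\<And>i j. i \<in> I \<Longrightarrow> j \<in> I \<Longrightarrow> i \<noteq> j \<Longrightarrow> S i \<inter> S j = {}"
  shows "\<exists>D. tiled k D (\<Union>i\<in>I. S i)"
  using assms
proof (induction rule: finite_induct)
  case empty
  then show ?case using tiled_empty by auto
next
  case (insert i I)
  obtain D where "tiled k D (S i)" using insert.prems by blast
  moreover obtain E where "tiled k E (\<Union>i\<in>I. S i)" using insert.IH insert.prems by auto
  moreover have "S i \<inter> S j = {}" if "j \<in> I" for j
    using insert.prems(2)[of i j] insert.hyps that by auto
  then have "S i \<inter> (\<Union>i\<in>I. S i) = {}" by blast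
  ultimately show ?case using tiled_Un[of k D "S i" E "\<Union>i\<in>I. S i"] by auto
qed

lemma tiled_remove:
  assumes "tiled k (add_mset d D) M"
  obtains L M' where "simple_linear k d L" "tiled k D M'" "L \<inter> M' = {}" "M = L \<union> M'"
proof -
  \<comment> \<open>Generalised to any multiset \<open>E\<close> containing \<open>d\<close>, since
    the wanted tile may have been inserted at any stage.\<close>
  have "\<exists>L M'. simple_linear k d L \<and> tiled k (E - {#d#}) M' \<and> L \<inter> M' = {} \<and> M = L \<union> M'"
    if "tiled k E M" "d \<in># E" for E
    using that
  proof induction
    case (tiled_insert D M d' L)
    show ?case
    proof (cases "d = d'")
      case True
      then show ?thesis using tiled_insert by (intro exI[of _ L] exI[of _ M]) auto
    next
      case False
      then obtain L1 M1 where 1: "simple_linear k d L1" "tiled k (D - {#d#}) M1" "L1 \<inter> M1 = {}" "M = L1 \<union> M1"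
        using tiled_insert by auto
      have "tiled k (add_mset d' (D - {#d#})) (L \<union> M1)"
        using 1 tiled_insert by (intro tiled.tiled_insert) auto
      then show ?thesis using 1 False tiled_insert
        by (intro exI[of _ L1] exI[of _ "L \<union> M1"]) auto
    qed
  qed simp
  from this[OF assms] obtain L M' where "simple_linear k d L" "tiled k D M'" "L \<inter> M' = {}" "M = L \<union> M'"
    by auto
  then show thesis by (rule that)
qed

text \<open>Injectivity is asked on \<open>R\<close> alone: this allows dependent periods once
  \<open>R\<close> selects one representation per point.\<close>

lemma tiled_lin_image:
  assumes "tiled d D R" "inj_on (lin b P d) R" "b \<in> vecs k" "\<And>j. j < d \<Longrightarrow> P j \<in> vecs k"
  shows "tiled k D (lin b P d ` R)"
  using assms(1,2)
proof induction
  case tiled_empty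
  then show ?case by (simp add: tiled.tiled_empty)
next
  case (tiled_insert D R m L)
  then obtain b' P' where L: "b' \<in> vecs d" "\<forall>j<m. P' j \<in> vecs d" "inj_on (lin b' P' m) (vecs m)"
    "L = lin b' P' m ` vecs m"
    by (auto simp: simple_linear_def)
  let ?f = "lin (lin b P d b') (\<lambda>j. lin (\<lambda>_. 0) P d (P' j)) m"
  have f: "?f = lin b P d \<circ> lin b' P' m" by (auto simp: lin_lin)
  have "inj_on ?f (vecs m)" unfolding f
    using L tiled_insert.prems by (intro comp_inj_on) (auto intro: inj_on_subset)
  moreover have "lin b P d ` L = ?f ` vecs m" by (simp add: f L image_comp)
  ultimately have "simple_linear k m (lin b P d ` L)"
    unfolding simple_linear_def using assms(3,4)
    by (intro exI[of _ "lin b P d b'"] exI[of _ "\<lambda>j. lin (\<lambda>_. 0) P d (P' j)"])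
      (auto intro!: lin_in_vecs)
  moreover have "lin b P d ` L \<inter> lin b P d ` R = {}"
    using tiled_insert.hyps tiled_insert.prems by (auto simp: inj_on_def)
  moreover have "tiled k D (lin b P d ` R)"
    using tiled_insert by (auto intro: inj_on_subset)
  ultimately show ?case by (simp add: image_Un tiled.tiled_insert)
qed

text \<open>Coordinates with \<open>v i < T\<close> are fixed and those with \<open>v i = T\<close>
  range freely upwards. The fibre is thus \<open>v\<close> plus the orthant spanned by the unit
  vectors at \<open>J\<close>, which \<open>h\<close> enumerates.\<close>

lemma tiled_truncation_fibre:
  assumes v: "v \<in> vecs d" "\<forall>i. v i \<le> T"
  shows "\<exists>D. tiled d D {c \<in> vecs d. \<forall>i. min (c i) T = v i}"
proof -
  define J where "J = {i. i < d \<and> v i = T}"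
  define m where "m = card J"
  have "finite J" by (simp add: J_def)
  then obtain h where h: "bij_betw h {..<m} J"
    unfolding m_def using ex_bij_betw_nat_finite[of J] by (auto simp: lessThan_atLeast0)
  define P where "P = (\<lambda>j i. if i = h j then 1 else 0 :: nat)"
  have at_h: "lin v P m c (h j) = T + c j" if "j < m" for c j
  proof -
    have "(\<Sum>j'<m. c j' * P j' (h j)) = (\<Sum>j'<m. if j' = j then c j else 0)"
      using that h by (intro sum.cong) (auto simp: P_def bij_betw_def inj_on_def)
    moreover have "v (h j) = T" using bij_betwE[OF h] that by (auto simp: J_def)
    ultimately show ?thesis using that by (simp add: lin_def)
  qed
  have off_J: "lin v P m c i = v i" if "i \<notin> J" for c i
  proof -
    have "(\<Sum>j<m. c j * P j i) = 0"
      using that bij_betwE[OF h] by (intro sum.neutral) (auto simp: P_def)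
    then show ?thesis by (simp add: lin_def)
  qed
  have J_cases: "i \<notin> J \<or> (\<exists>j<m. i = h j)" for i
    using h by (auto simp: bij_betw_def)
  have "inj_on (lin v P m) (vecs m)"
  proof (rule inj_onI, rule ext)
    fix c c' j assume "c \<in> vecs m" "c' \<in> vecs m" "lin v P m c = lin v P m c'"
    then show "c j = c' j"
      using at_h[of j c] at_h[of j c'] by (cases "j < m") (auto simp: vecs_def)
  qed
  moreover have "{c \<in> vecs d. \<forall>i. min (c i) T = v i} = lin v P m ` vecs m"
  proof (intro equalityI subsetI)
    fix x assume "x \<in> {c \<in> vecs d. \<forall>i. min (c i) T = v i}"
    then have x: "x \<in> vecs d" "\<And>i. min (x i) T = v i" by auto
    define c where "c = (\<lambda>j. if j < m then x (h j) - T else 0)"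
    have "x i = lin v P m c i" for i
    proof (cases "i \<in> J")
      case True
      then obtain j where "j < m" "i = h j" using J_cases by blast
      then show ?thesis using at_h[of j c] x(2)[of i] True by (auto simp: c_def J_def)
    next
      case False
      then show ?thesis using off_J[OF False, of c] x(1) x(2)[of i] v(1)
        by (cases "i < d") (auto simp: J_def vecs_def min_def split: if_splits)
    qed
    then show "x \<in> lin v P m ` vecs m" by (intro image_eqI[of _ _ c]) (auto simp: c_def vecs_def)
  next
    fix x assume "x \<in> lin v P m ` vecs m"
    then obtain c where c: "x = lin v P m c" by blast
    have "min (x i) T = v i" for i
      using J_cases[of i] off_J[of i c] at_h[of _ c] v(2) bij_betwE[OF h] c by (auto simp: J_def)
    moreover have "x \<in> vecs d"
      using off_J[of _ c] v(1) c by (auto simp: vecs_def J_def)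
    ultimately show "x \<in> {c \<in> vecs d. \<forall>i. min (c i) T = v i}" by simp
  qed
  moreover have "P j \<in> vecs d" if "j < m" for j
    using bij_betw_apply[OF h, of j] that by (auto simp: P_def vecs_def J_def)
  ultimately have "simple_linear d m {c \<in> vecs d. \<forall>i. min (c i) T = v i}"
    unfolding simple_linear_def using v(1) by (intro exI[of _ v] exI[of _ P]) simp
  then show ?thesis using tiled_simple by blast
qed

text \<open>The complement is an upset with finitely many minimal elements, so membership of \<open>c\<close> only depends on
  \<open>min (c i) T\<close> for an upper bound \<open>T\<close> of their coordinates.\<close>
lemma tiled_downset:
  assumes "R \<subseteq> vecs d"
    and down: "\<And>c c'. c' \<in> R \<Longrightarrow> c \<in> vecs d \<Longrightarrow> \<forall>i. c i \<le> c' i \<Longrightarrow> c \<in> R"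
  shows "\<exists>D. tiled d D R"
proof -
  obtain B where B: "finite B" "B \<subseteq> vecs d - R"
    "\<And>a. a \<in> vecs d - R \<Longrightarrow> \<exists>b\<in>B. \<forall>f\<in>(\<lambda>i c. c i) ` {..<d}. f b \<le> f a"
    using dickson[of "(\<lambda>i c. c i) ` {..<d}" "vecs d - R"] by auto
  have "finite ((\<lambda>(b, i). b i) ` (B \<times> {..<d}))" using B(1) by simp
  then obtain T where "\<forall>n\<in>(\<lambda>(b, i). b i) ` (B \<times> {..<d}). n \<le> T"
    unfolding finite_nat_set_iff_bounded_le ..
  then have T: "b i \<le> T" if "b \<in> B" "i < d" for b i using that by auto
  have trunc: "(\<lambda>i. min (c i) T) \<in> R \<longleftrightarrow> c \<in> R" if c: "c \<in> vecs d" for c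
  proof
    assume "c \<in> R"
    then show "(\<lambda>i. min (c i) T) \<in> R" using c by (rule_tac down) (auto simp: vecs_def)
  next
    assume *: "(\<lambda>i. min (c i) T) \<in> R"
    show "c \<in> R"
    proof (rule ccontr)
      assume "c \<notin> R"
      then obtain b where b: "b \<in> B" "\<forall>i<d. b i \<le> c i" using B(3)[of c] c by auto
      have "b i \<le> min (c i) T" for i
        using b T[OF b(1), of i] B(2) by (cases "i < d") (auto simp: vecs_def)
      then have "b \<in> R" using * b(1) B(2) by (rule_tac down) auto
      then show False using b(1) B(2) by auto
    qed
  qed
  define I where "I = {v \<in> R. \<forall>i. v i \<le> T}"
  have "finite I" using assms(1) by (intro finite_subset[OF _ finite_bounded_vecs[of d T]]) (auto simp: I_def)
  then have "\<exists>D. tiled d D (\<Union>v\<in>I. {c \<in> vecs d. \<forall>i. min (c i) T = v i})"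
  proof (rule tiled_UN)
    show "\<exists>D. tiled d D {c \<in> vecs d. \<forall>i. min (c i) T = v i}" if "v \<in> I" for v
      using that assms(1) by (intro tiled_truncation_fibre) (auto simp: I_def)
  qed (auto simp: fun_eq_iff)
  also have "(\<Union>v\<in>I. {c \<in> vecs d. \<forall>i. min (c i) T = v i}) = R"
  proof (intro equalityI subsetI)
    fix c assume "c \<in> (\<Union>v\<in>I. {c \<in> vecs d. \<forall>i. min (c i) T = v i})"
    then obtain v where "v \<in> R" "c \<in> vecs d" "(\<lambda>i. min (c i) T) = v" by (auto simp: I_def)
    then show "c \<in> R" using trunc by auto
  next
    fix c assume "c \<in> R"
    then show "c \<in> (\<Union>v\<in>I. {c \<in> vecs d. \<forall>i. min (c i) T = v i})"
      using trunc[of c] assms(1) by (intro UN_I[of "\<lambda>i. min (c i) T"]) (auto simp: I_def)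
  qed
  finally show ?thesis .
qed

section \<open>Lexicographically least representations\<close>

definition lexless :: "nat \<Rightarrow> (nat \<Rightarrow> nat) \<Rightarrow> (nat \<Rightarrow> nat) \<Rightarrow> bool" where
  "lexless n c c' \<longleftrightarrow> (\<exists>i<n. c i < c' i \<and> (\<forall>j<i. c j = c' j))"

lemma lexless_total:
  assumes "c \<in> vecs n" "c' \<in> vecs n" "\<not> lexless n c c'" "\<not> lexless n c' c"
  shows "c = c'"
proof (rule ccontr)
  assume "c \<noteq> c'"
  then have ex: "\<exists>i. c i \<noteq> c' i" by auto
  define i where "i = (LEAST i. c i \<noteq> c' i)"
  have "c i \<noteq> c' i" unfolding i_def using LeastI_ex[OF ex] .
  moreover have "\<forall>j<i. c j = c' j" unfolding i_def using not_less_Least by blast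
  moreover have "i < n" using \<open>c i \<noteq> c' i\<close> assms(1,2) by (cases "i < n") (auto simp: vecs_def)
  ultimately show False using assms(3,4) unfolding lexless_def
    by (metis linorder_neqE_nat)
qed

lemma lexless_asym:
  assumes "lexless n s t"
  shows "\<not> lexless n t s"
proof
  assume "lexless n t s"
  then obtain j where j: "t j < s j" "\<forall>m<j. t m = s m" by (auto simp: lexless_def)
  obtain i where "s i < t i" "\<forall>m<i. s m = t m" using assms by (auto simp: lexless_def)
  then show False using j by (cases i j rule: linorder_cases) auto
qed

text \<open>Induction on the number of compared coordinates: among the elements that share the least
  prefix, one with the smallest next coordinate is chosen. The inner claim is the stronger one that
  \<open>s\<close> is comparable with every element.\<close>

lemma lexless_minimal_exists:
  assumes "S \<noteq> {}"
  shows "\<exists>s\<in>S. \<forall>t\<in>S. \<not> lexless n t s"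
proof -
  have "\<exists>s\<in>S. \<forall>t\<in>S. (\<forall>i<n. t i = s i) \<or> lexless n s t"
  proof (induction n)
    case (Suc n)
    then obtain s where s: "s \<in> S" "\<And>t. t \<in> S \<Longrightarrow> (\<forall>i<n. t i = s i) \<or> lexless n s t" by blast
    define Q where "Q t \<longleftrightarrow> t \<in> S \<and> (\<forall>i<n. t i = s i)" for t
    define u where "u = arg_min (\<lambda>t. t n) Q"
    have u: "Q u" "\<And>t. Q t \<Longrightarrow> u n \<le> t n"
      unfolding u_def using arg_min_nat_lemma[of Q s "\<lambda>t. t n"] s(1) by (auto simp: Q_def)
    have "(\<forall>i<Suc n. t i = u i) \<or> lexless (Suc n) u t" if "t \<in> S" for t
    proof (cases "Q t")
      case True
      then show ?thesis using u(2)[OF True] u(1) unfolding lexless_def Q_def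
        by (cases "u n = t n") (auto simp: less_Suc_eq intro!: exI[of _ n])
    next
      case False
      then have "lexless n s t" using s(2)[OF that] that by (auto simp: Q_def)
      then obtain i where "i < n" "s i < t i" "\<forall>j<i. s j = t j" by (auto simp: lexless_def)
      then show ?thesis using u(1) unfolding Q_def lexless_def
        by (intro disjI2 exI[of _ i]) auto
    qed
    then show ?case using u(1) by (auto simp: Q_def)
  qed (use assms in auto)
  then obtain s where s: "s \<in> S" "\<And>t. t \<in> S \<Longrightarrow> (\<forall>i<n. t i = s i) \<or> lexless n s t" by blast
  have "\<not> lexless n t s" if "t \<in> S" for t
    using s(2)[OF that] lexless_asym[of n s t] by (auto simp: lexless_def)
  then show ?thesis using s(1) by blast
qed

text \<open>Smaller representations are preserved by adding the same vector to both sides, and this includes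
  representations over another base point because the periods are shared.  Hence the least
  representations of new points form a downset.\<close>
lemma tiled_hybrid_linear:
  assumes "finite B" "B \<subseteq> vecs k" "\<forall>j<d. P j \<in> vecs k"
  shows "\<exists>D. tiled k D (\<Union>b\<in>B. lin b P d ` vecs d)"
  using assms(1,2)
proof (induction rule: finite_induct)
  case empty
  then show ?case using tiled_empty by auto
next
  case (insert b B)
  define U where "U = (\<Union>b\<in>B. lin b P d ` vecs d)"
  obtain D where D: "tiled k D U" using insert unfolding U_def by auto
  define R where "R = {c \<in> vecs d. (\<forall>t\<in>vecs d. lin b P d t = lin b P d c \<longrightarrow> \<not> lexless d t c) \<and>
    lin b P d c \<notin> U}"
  have "\<exists>E. tiled d E R"
  proof (rule tiled_downset)
    fix c c' assume c': "c' \<in> R" and c: "c \<in> vecs d" and le: "\<forall>i. c i \<le> c' i"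
    define h where "h = (\<lambda>i. c' i - c i)"
    have c'_eq: "c' = (\<lambda>i. c i + h i)" using le by (auto simp: h_def)
    have h: "h \<in> vecs d" using c' by (auto simp: R_def h_def vecs_def)
    have add_in: "(\<lambda>i. t i + h i) \<in> vecs d" if "t \<in> vecs d" for t
      using that h by (auto simp: vecs_def)
    have shift: "lin a P d (\<lambda>i. t i + h i) = lin b P d c'" if "lin a P d t = lin b P d c" for a t
      using that unfolding c'_eq by (auto simp: fun_eq_iff lin_add)
    have "\<not> lexless d t c" if t: "t \<in> vecs d" "lin b P d t = lin b P d c" for t
    proof -
      have "\<not> lexless d (\<lambda>i. t i + h i) c'"
        using c' add_in[OF t(1)] shift[OF t(2)] by (auto simp: R_def)
      then show ?thesis unfolding lexless_def c'_eq by simp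
    qed
    moreover have "lin b P d c \<notin> U"
    proof
      assume "lin b P d c \<in> U"
      then obtain a t where at: "a \<in> B" "t \<in> vecs d" "lin a P d t = lin b P d c"
        unfolding U_def by auto
      then have "lin b P d c' \<in> U"
        using shift[OF at(3)] add_in[OF at(2)] unfolding U_def by (metis UN_I imageI)
      then show False using c' by (simp add: R_def)
    qed
    ultimately show "c \<in> R" using c by (simp add: R_def)
  qed (auto simp: R_def)
  then obtain E where E: "tiled d E R" ..
  \<comment> \<open>Two least representations of one point are incomparable, hence equal by
    totality.\<close>
  have "inj_on (lin b P d) R"
    by (rule inj_onI) (auto simp: R_def intro!: lexless_total[of _ d])
  then have "tiled k E (lin b P d ` R)"
    using E insert.prems assms(3) by (intro tiled_lin_image) auto
  then have "tiled k (D + E) (U \<union> lin b P d ` R)"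
    using D by (intro tiled_Un) (auto simp: R_def)
  moreover have "lin b P d ` vecs d \<subseteq> U \<union> lin b P d ` R"
  proof
    fix x assume x: "x \<in> lin b P d ` vecs d"
    show "x \<in> U \<union> lin b P d ` R"
    proof (cases "x \<in> U")
      case False
      have "{t \<in> vecs d. lin b P d t = x} \<noteq> {}" using x by auto
      from lexless_minimal_exists[OF this, of d] show ?thesis using False by (force simp: R_def)
    qed simp
  qed
  then have "U \<union> lin b P d ` R = (\<Union>b\<in>insert b B. lin b P d ` vecs d)"
    by (auto simp: R_def U_def)
  ultimately show ?case by auto
qed

section \<open>Tilings of definable sets\<close>

text \<open>A form of Gordan's lemma for the monoid of directions of a cell. Dickson's lemma gives
  finitely many nonzero elements below all others; subtracting one of them stays in \<open>H\<close>
  and lowers the coordinate sum, so the descent ends at zero.\<close>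

lemma linear_monoid_finitely_generated:
  fixes k N :: nat
  assumes "finite A" "\<forall>\<alpha>\<in>A. affine \<alpha>"
  defines "H \<equiv> {h \<in> vecs k. (\<forall>\<alpha>\<in>A. \<alpha> (\<lambda>_. 0) \<le> \<alpha> h) \<and> (\<forall>i. N dvd h i)}"
  shows "\<exists>d P. (\<forall>j<d. P j \<in> H) \<and> H = lin (\<lambda>_. 0) P d ` vecs d"
proof -
  \<comment> \<open>Comparing the values of the linear parts as well as the coordinates keeps the
    inequalities true for \<open>h - p\<close>. On \<open>H\<close> these values are nonnegative, so
    \<open>nat\<close> is faithful.\<close>
  define F where "F = (\<lambda>i h. h i) ` {..<k} \<union> (\<lambda>\<alpha> h. nat (\<alpha> h - \<alpha> (\<lambda>_. 0))) ` A"
  have "finite F" using assms(1) by (simp add: F_def)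
  from dickson[OF this, of "H - {\<lambda>_. 0}"] obtain G where
    G: "finite G" "G \<subseteq> H - {\<lambda>_. 0}" "\<forall>a\<in>H - {\<lambda>_. 0}. \<exists>b\<in>G. \<forall>f\<in>F. f b \<le> f a"
    by blast
  obtain d P where P: "G = P ` {i::nat. i < d}"
    using G(1) by (auto simp: finite_conv_nat_seg_image)
  have PH: "P j \<in> H" "P j \<noteq> (\<lambda>_. 0)" if "j < d" for j
    using G(2) P that by auto
  have add: "(\<lambda>i. u i + v i) \<in> H" if "u \<in> H" "v \<in> H" for u v
  proof -
    have "\<alpha> (\<lambda>_. 0) \<le> \<alpha> (\<lambda>i. u i + v i)" if "\<alpha> \<in> A" for \<alpha>
    proof -
      have "\<alpha> (\<lambda>_. 0) \<le> \<alpha> u" "\<alpha> (\<lambda>_. 0) \<le> \<alpha> v"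
        using \<open>u \<in> H\<close> \<open>v \<in> H\<close> that by (auto simp: H_def)
      then show ?thesis using affine_plus[of \<alpha> u v] that assms(2) by auto
    qed
    then show ?thesis using that by (auto simp: H_def vecs_def)
  qed
  have gen: "\<exists>c\<in>vecs d. h = lin (\<lambda>_. 0) P d c" if "h \<in> H" for h
    using that
  proof (induction "\<Sum>i<k. h i" arbitrary: h rule: less_induct)
    case less
    show ?case
    proof (cases "h = (\<lambda>_. 0)")
      case True
      then show ?thesis by (intro bexI[of _ "\<lambda>_. 0"]) (auto simp: lin_def)
    next
      case False
      then obtain p where p: "p \<in> G" "\<forall>f\<in>F. f p \<le> f h" using G(3) less.prems by auto
      then obtain j where j: "j < d" "p = P j" using P by auto
      have pv: "p \<in> vecs k" "p \<noteq> (\<lambda>_. 0)" using p(1) G(2) by (auto simp: H_def)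
      have le: "p i \<le> h i" for i
        using p(2) pv less.prems by (cases "i < k") (auto simp: F_def H_def vecs_def)
      define g where "g = (\<lambda>i. h i - p i)"
      have h_eq: "h = (\<lambda>i. p i + g i)" using le by (auto simp: g_def)
      have "\<alpha> (\<lambda>_. 0) \<le> \<alpha> g" if "\<alpha> \<in> A" for \<alpha>
      proof -
        have "nat (\<alpha> p - \<alpha> (\<lambda>_. 0)) \<le> nat (\<alpha> h - \<alpha> (\<lambda>_. 0))" "\<alpha> (\<lambda>_. 0) \<le> \<alpha> h"
          using p(2) that less.prems by (auto simp: F_def H_def)
        then show ?thesis using affine_plus[of \<alpha> p g] that assms(2) unfolding h_eq by auto
      qed
      moreover have "N dvd g i" for i
        using less.prems p(1) G(2) by (auto simp: g_def H_def intro: dvd_diff_nat)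
      ultimately have "g \<in> H" using less.prems by (auto simp: H_def g_def vecs_def)
      moreover have "(\<Sum>i<k. g i) < (\<Sum>i<k. h i)"
      proof -
        obtain i where "p i \<noteq> 0" using pv(2) by auto
        moreover from this have "i < k" using pv(1) by (cases "i < k") (auto simp: vecs_def)
        ultimately have "i < k" "g i < h i" using le[of i] by (auto simp: g_def)
        then show ?thesis by (intro sum_strict_mono_ex1) (auto simp: g_def)
      qed
      ultimately obtain c where c: "c \<in> vecs d" "g = lin (\<lambda>_. 0) P d c"
        using less.hyps by blast
      let ?u = "\<lambda>i. if i = j then 1 else 0 :: nat"
      have "(\<Sum>m<d. ?u m * P m i) = P j i" for i
        using j(1) by (simp add: if_distrib[of "\<lambda>x. x * _"] cong: if_cong)
      then have "h = lin (\<lambda>_. 0) P d (\<lambda>i. c i + ?u i)"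
        unfolding h_eq c(2) j(2) by (auto simp: lin_add)
      moreover have "(\<lambda>i. c i + ?u i) \<in> vecs d" using c(1) j(1) by (auto simp: vecs_def)
      ultimately show ?thesis by blast
    qed
  qed
  have "(\<lambda>i. \<Sum>j<m. c j * P j i) \<in> H" if "m \<le> d" for c m
    using that
  proof (induction m)
    case 0
    then show ?case by (simp add: H_def)
  next
    case (Suc m)
    have "(\<lambda>i. t * P m i) \<in> H" for t
    proof (induction t)
      case 0
      then show ?case by (simp add: H_def)
    next
      case (Suc t)
      then show ?case using add[of "P m" "\<lambda>i. t * P m i"] PH \<open>Suc m \<le> d\<close> by simp
    qed
    then show ?case using add Suc by simp
  qed
  then have "lin (\<lambda>_. 0) P d c \<in> H" for c by (simp add: lin_def)
  then show ?thesis using gen PH(1) by (intro exI[of _ d] exI[of _ P]) blast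
qed

text \<open>Every point of the cell lies above some \<open>b\<close> in \<open>B\<close>, and the
  difference is a direction in \<open>H\<close>. As \<open>H\<close> involves only \<open>N\<close>
  and the linear parts, not the constant terms or residues, one set of periods serves all base
  points.\<close>

lemma cell_hybrid_linear:
  assumes "finite A" "\<forall>\<alpha>\<in>A. affine \<alpha>"
  shows "\<exists>B d P. finite B \<and> B \<subseteq> vecs k \<and> (\<forall>j<d. P j \<in> vecs k) \<and>
    {e \<in> vecs k. (\<forall>\<alpha>\<in>A. 0 \<le> \<alpha> e) \<and> (\<forall>i. e i mod N = r i)} = (\<Union>b\<in>B. lin b P d ` vecs d)"
proof -
  define C where "C = {e \<in> vecs k. (\<forall>\<alpha>\<in>A. 0 \<le> \<alpha> e) \<and> (\<forall>i. e i mod N = r i)}"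
  define H where "H = {h \<in> vecs k. (\<forall>\<alpha>\<in>A. \<alpha> (\<lambda>_. 0) \<le> \<alpha> h) \<and> (\<forall>i. N dvd h i)}"
  obtain d P where P: "\<forall>j<d. P j \<in> H" "H = lin (\<lambda>_. 0) P d ` vecs d"
    using linear_monoid_finitely_generated[OF assms, of k N] unfolding H_def by blast
  define F where "F = (\<lambda>i e. e i) ` {..<k} \<union> (\<lambda>\<alpha> e. nat (\<alpha> e)) ` A"
  have "finite F" using assms(1) by (simp add: F_def)
  from dickson[OF this, of C] obtain B where
    B: "finite B" "B \<subseteq> C" "\<forall>a\<in>C. \<exists>b\<in>B. \<forall>f\<in>F. f b \<le> f a"
    by blast
  have split: "lin b P d c = (\<lambda>i. b i + lin (\<lambda>_. 0) P d c i)" for b c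
    by (simp add: lin_def)
  have "C = (\<Union>b\<in>B. lin b P d ` vecs d)"
  proof (intro equalityI subsetI)
    fix x assume x: "x \<in> C"
    then obtain b where b: "b \<in> B" "\<forall>f\<in>F. f b \<le> f x" using B(3) by blast
    have bC: "b \<in> C" using b(1) B(2) by blast
    have le: "b i \<le> x i" for i
      using b(2) x bC by (cases "i < k") (auto simp: F_def C_def vecs_def)
    define h where "h = (\<lambda>i. x i - b i)"
    have x_eq: "x = (\<lambda>i. b i + h i)" using le by (auto simp: h_def)
    have "\<alpha> (\<lambda>_. 0) \<le> \<alpha> h" if "\<alpha> \<in> A" for \<alpha>
    proof -
      have "nat (\<alpha> b) \<le> nat (\<alpha> x)" "0 \<le> \<alpha> x" "0 \<le> \<alpha> b"
        using b(2) that x bC by (auto simp: F_def C_def)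
      then show ?thesis using affine_plus[of \<alpha> b h] that assms(2) unfolding x_eq by auto
    qed
    moreover have "N dvd h i" for i
    proof -
      have "x i mod N = b i mod N" using x bC by (simp add: C_def)
      then show ?thesis using le[of i] by (simp add: h_def mod_eq_dvd_iff_nat)
    qed
    ultimately have "h \<in> H" using x by (auto simp: H_def h_def C_def vecs_def)
    then obtain c where "c \<in> vecs d" "h = lin (\<lambda>_. 0) P d c" using P(2) by blast
    then have "x = lin b P d c" "c \<in> vecs d" using split[of b c] x_eq by auto
    then show "x \<in> (\<Union>b\<in>B. lin b P d ` vecs d)" using b(1) by blast
  next
    fix x assume "x \<in> (\<Union>b\<in>B. lin b P d ` vecs d)"
    then obtain b c where bc: "b \<in> B" "c \<in> vecs d" "x = lin b P d c" by blast
    define h where "h = lin (\<lambda>_. 0) P d c"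
    have h: "h \<in> H" using bc P(2) by (auto simp: h_def)
    have x_eq: "x = (\<lambda>i. b i + h i)" using bc(3) split[of b c] by (simp add: h_def)
    have bC: "b \<in> C" using bc(1) B(2) by blast
    have "0 \<le> \<alpha> x" if "\<alpha> \<in> A" for \<alpha>
    proof -
      have "\<alpha> (\<lambda>_. 0) \<le> \<alpha> h" "0 \<le> \<alpha> b" using that h bC by (auto simp: H_def C_def)
      then show ?thesis using affine_plus[of \<alpha> b h] that assms(2) unfolding x_eq by auto
    qed
    moreover have "x i mod N = r i" for i
    proof -
      have "N dvd h i" "b i mod N = r i" using h bC by (auto simp: H_def C_def)
      then show ?thesis unfolding x_eq by (auto simp: mod_add_right_eq)
    qed
    ultimately show "x \<in> C" using h bC unfolding x_eq by (auto simp: H_def C_def vecs_def)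
  qed
  then show ?thesis using B P(1) unfolding C_def
    by (intro exI[of _ B] exI[of _ d] exI[of _ P]) (auto simp: H_def)
qed

lemma assign_image_tuples: "assign ` {xs \<in> tuples k. Q (assign xs)} = {e \<in> vecs k. Q e}"
proof (intro equalityI subsetI)
  fix e assume e: "e \<in> {e \<in> vecs k. Q e}"
  have "assign (map e [0..<k]) = e"
    using e by (auto simp: assign_def vecs_def fun_eq_iff)
  then show "e \<in> assign ` {xs \<in> tuples k. Q (assign xs)}"
    using e by (intro image_eqI[of _ _ "map e [0..<k]"]) (auto simp: tuples_def)
qed (auto simp: tuples_def vecs_def assign_def)

lemma definable_tiled:
  assumes "definable k M"
  shows "\<exists>D. tiled k D (assign ` M)"
proof -
  obtain p where p: "M = {xs \<in> tuples k. sat (assign xs) p}"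
    using assms unfolding definable_def by blast
  from sat_determined[of p] obtain A N where A: "finite A" "\<forall>\<alpha>\<in>A. affine \<alpha>" "N > 0"
    "\<forall>e e'. indist A N e e' \<longrightarrow> sat e p = sat e' p"
    by (elim exE conjE) (rule that)
  \<comment> \<open>The fibres of \<open>sig\<close> on \<open>vecs k\<close> are the cells; truth
    of \<open>p\<close> is constant on each.\<close>
  define sig where "sig e = ({\<alpha> \<in> A. 0 \<le> \<alpha> e}, \<lambda>i. e i mod N)" for e
  define X where "X = {e \<in> vecs k. sat e p}"
  have sat_cong: "sat e p = sat e' p" if "sig e = sig e'" for e e'
  proof -
    have "indist A N e e'" using that unfolding indist_def sig_def by (auto simp: fun_eq_iff)
    then show ?thesis using A(4) by blast
  qed
  \<comment> \<open>From coordinate \<open>k\<close> on all residues are 0, so only finitely many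
    signatures occur.\<close>
  have "sig ` X \<subseteq> Pow A \<times> {f. \<forall>x. (x \<in> {..<k} \<longrightarrow> f x \<in> {..<N}) \<and> (x \<notin> {..<k} \<longrightarrow> f x = 0)}"
    using A(3) by (auto simp: sig_def X_def vecs_def)
  then have "finite (sig ` X)"
    by (rule finite_subset) (intro finite_cartesian_product finite_set_of_finite_funs; simp add: A(1))
  then have "\<exists>D. tiled k D (\<Union>s\<in>sig ` X. {e \<in> vecs k. sig e = s})"
  proof (rule tiled_UN)
    fix s assume "s \<in> sig ` X"
    then obtain e0 where s: "s = sig e0" by blast
    \<comment> \<open>Over the integers \<open>\<alpha> e < 0\<close> is
      \<open>0 \<le> - 1 - \<alpha> e\<close>, so a cell needs only conditions of one shape.\<close>
    define A' where "A' = {\<alpha> \<in> A. 0 \<le> \<alpha> e0} \<union> (\<lambda>\<alpha> e. - 1 - \<alpha> e) ` {\<alpha> \<in> A. \<not> 0 \<le> \<alpha> e0}"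
    have A': "finite A'" "\<forall>\<alpha>\<in>A'. affine \<alpha>"
      using A(1,2) by (auto simp: A'_def intro!: affine_diff affine_const)
    have "{e \<in> vecs k. sig e = s} =
        {e \<in> vecs k. (\<forall>\<alpha>\<in>A'. 0 \<le> \<alpha> e) \<and> (\<forall>i. e i mod N = e0 i mod N)}" (is "?l = ?r")
    proof -
      have "(\<forall>\<alpha>\<in>A'. 0 \<le> \<alpha> e) \<longleftrightarrow> {\<alpha> \<in> A. 0 \<le> \<alpha> e} = {\<alpha> \<in> A. 0 \<le> \<alpha> e0}" for e
      proof -
        have "(\<forall>\<alpha>\<in>A'. 0 \<le> \<alpha> e) \<longleftrightarrow> (\<forall>\<alpha>\<in>A. if 0 \<le> \<alpha> e0 then 0 \<le> \<alpha> e else 0 \<le> - 1 - \<alpha> e)"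
          unfolding A'_def ball_Un ball_simps by auto
        also have "\<dots> \<longleftrightarrow> (\<forall>\<alpha>\<in>A. 0 \<le> \<alpha> e \<longleftrightarrow> 0 \<le> \<alpha> e0)"
          by (intro ball_cong refl) auto
        finally show ?thesis by blast
      qed
      then show ?thesis by (auto simp: s sig_def fun_eq_iff)
    qed
    from cell_hybrid_linear[OF A', of k N "\<lambda>i. e0 i mod N"] obtain B d P where
      B: "finite B" "B \<subseteq> vecs k" "\<forall>j<d. P j \<in> vecs k"
      and r: "?r = (\<Union>b\<in>B. lin b P d ` vecs d)"
      by (elim exE conjE) (rule that)
    show "\<exists>D. tiled k D ?l"
      unfolding \<open>?l = ?r\<close> r by (rule tiled_hybrid_linear[OF B])
  next
    fix s t :: "((nat \<Rightarrow> nat) \<Rightarrow> int) set \<times> (nat \<Rightarrow> nat)"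
    assume "s \<noteq> t"
    then show "{e \<in> vecs k. sig e = s} \<inter> {e \<in> vecs k. sig e = t} = {}" by blast
  qed
  also have "(\<Union>s\<in>sig ` X. {e \<in> vecs k. sig e = s}) = X"
  proof (intro equalityI subsetI)
    fix e assume "e \<in> (\<Union>s\<in>sig ` X. {e \<in> vecs k. sig e = s})"
    then obtain e' where "e \<in> vecs k" "e' \<in> X" "sig e = sig e'" by blast
    then show "e \<in> X" using sat_cong[of e e'] by (simp add: X_def)
  next
    fix e assume "e \<in> X"
    then show "e \<in> (\<Union>s\<in>sig ` X. {e \<in> vecs k. sig e = s})"
      unfolding X_def by blast
  qed
  also have "X = assign ` M" unfolding p X_def by (rule assign_image_tuples[symmetric])
  finally show ?thesis .
qed

section \<open>Splitting moves on tilings\<close>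

lemma lin_diagonal:
  assumes "c \<in> vecs m"
  shows "lin b (\<lambda>j i. if i = j then a j else 0) m c = (\<lambda>i. b i + c i * a i)"
proof
  fix i
  have "(\<Sum>j<m. c j * (if i = j then a j else 0)) = (if i < m then c i * a i else 0)"
    by (simp add: if_distrib[of "\<lambda>x. _ * x"] cong: if_cong)
  then show "lin b (\<lambda>j i. if i = j then a j else 0) m c i = b i + c i * a i"
    using assms by (auto simp: lin_def vecs_def)
qed

text \<open>Provides the tiles of both moves: for parity, \<open>a\<close> is 2 at the halved
  coordinate and 1 elsewhere; for the zero test it is constantly 1.\<close>

lemma simple_diagonal:
  assumes "b \<in> vecs n" "m \<le> n" "\<And>i. a i > 0"
  shows "simple_linear n m ((\<lambda>c i. b i + c i * a i) ` vecs m)"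
  unfolding simple_linear_def
proof (intro exI conjI)
  let ?P = "\<lambda>j i. if i = j then a j else 0"
  show "\<forall>j<m. ?P j \<in> vecs n" using assms by (auto simp: vecs_def)
  show "inj_on (lin b ?P m) (vecs m)"
  proof (intro inj_onI ext)
    fix c c' i assume "c \<in> vecs m" "c' \<in> vecs m" "lin b ?P m c = lin b ?P m c'"
    then have "b i + c i * a i = b i + c' i * a i" by (simp only: lin_diagonal) metis
    then show "c i = c' i" using assms(3)[of i] by simp
  qed
  show "(\<lambda>c i. b i + c i * a i) ` vecs m = lin b ?P m ` vecs m"
    by (simp add: lin_diagonal)
qed (use assms in auto)

lemma tiled_vecs: "tiled n {#n#} (vecs n)"
  using tiled_simple[OF simple_diagonal[of "\<lambda>_. 0" n n "\<lambda>_. 1"]] by simp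

lemma tiled_vecs_split_parity: "tiled (Suc n) {#Suc n, Suc n#} (vecs (Suc n))"
proof -
  let ?u = "\<lambda>i. if i = n then 1 else 0 :: nat"
  let ?a = "\<lambda>i. if i = n then 2 else 1 :: nat"
  let ?E = "(\<lambda>c i. 0 + c i * ?a i) ` vecs (Suc n)"
  let ?O = "(\<lambda>c i. ?u i + c i * ?a i) ` vecs (Suc n)"
  have E: "tiled (Suc n) {#Suc n#} ?E"
    by (rule tiled_simple, rule simple_diagonal[of "\<lambda>_. 0" "Suc n" "Suc n" ?a]) auto
  have O: "tiled (Suc n) {#Suc n#} ?O"
    by (rule tiled_simple, rule simple_diagonal[of ?u "Suc n" "Suc n" ?a]) (auto simp: vecs_def)
  have disj: "?E \<inter> ?O = {}"
  proof -
    have "even (x n)" if "x \<in> ?E" for x using that by auto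
    moreover have "odd (x n)" if "x \<in> ?O" for x using that by auto
    ultimately show ?thesis by blast
  qed
  have un: "?E \<union> ?O = vecs (Suc n)"
  proof (intro equalityI subsetI)
    fix x assume x: "x \<in> vecs (Suc n)"
    let ?c = "\<lambda>i. if i = n then x i div 2 else x i"
    have c: "?c \<in> vecs (Suc n)" using x by (auto simp: vecs_def)
    show "x \<in> ?E \<union> ?O"
    proof (cases "even (x n)")
      case True
      then show ?thesis by (intro UnI1 image_eqI[OF _ c] ext) auto
    next
      case False
      then show ?thesis by (intro UnI2 image_eqI[OF _ c] ext) (auto elim!: oddE)
    qed
  qed (auto simp: vecs_def)
  show ?thesis using tiled_Un[OF E O disj] unfolding un by simp
qed

lemma tiled_vecs_split_zero: "tiled (Suc n) {#Suc n, n#} (vecs (Suc n))"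
proof -
  let ?u = "\<lambda>i. if i = n then 1 else 0 :: nat"
  let ?Z = "(\<lambda>c i. 0 + c i * 1) ` vecs n"
  let ?S = "(\<lambda>c i. ?u i + c i * 1) ` vecs (Suc n)"
  have Z: "tiled (Suc n) {#n#} ?Z"
    by (rule tiled_simple, rule simple_diagonal[of "\<lambda>_. 0" "Suc n" n "\<lambda>_. 1"]) auto
  have S: "tiled (Suc n) {#Suc n#} ?S"
    by (rule tiled_simple, rule simple_diagonal[of ?u "Suc n" "Suc n" "\<lambda>_. 1"])
      (auto simp: vecs_def)
  have disj: "?S \<inter> ?Z = {}"
  proof -
    have "x n = 0" if "x \<in> ?Z" for x using that by (auto simp: vecs_def)
    moreover have "x n > 0" if "x \<in> ?S" for x using that by auto
    ultimately show ?thesis by fastforce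
  qed
  have un: "?S \<union> ?Z = vecs (Suc n)"
  proof (intro equalityI subsetI)
    fix x assume x: "x \<in> vecs (Suc n)"
    show "x \<in> ?S \<union> ?Z"
    proof (cases "x n = 0")
      case True
      then have "x i = 0" if "i \<ge> n" for i
        using x that by (cases "i = n") (auto simp: vecs_def)
      then have "x \<in> vecs n" by (simp add: vecs_def)
      then show ?thesis by (intro UnI2 image_eqI[of _ _ x]) auto
    next
      case False
      moreover have "(\<lambda>i. x i - ?u i) \<in> vecs (Suc n)" using x by (auto simp: vecs_def)
      ultimately show ?thesis by (intro UnI1 image_eqI[of _ _ "\<lambda>i. x i - ?u i"] ext) auto
    qed
  qed (auto simp: vecs_def)
  show ?thesis using tiled_Un[OF S Z disj] unfolding un by (simp add: add_mset_commute)
qed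

text \<open>A tile is an injective affine image of \<open>vecs d\<close>, so the two tilings of
  \<open>vecs d\<close> carry over to it while the other tiles stay.\<close>

lemma tiled_split:
  assumes "tiled k D M" "d \<in># D" "d > 0"
  shows "tiled k (add_mset d D) M" "tiled k (add_mset (d - 1) D) M"
proof -
  obtain n where n: "d = Suc n" using assms(3) gr0_implies_Suc by blast
  have D: "tiled k (add_mset d (D - {#d#})) M" using assms by simp
  from tiled_remove[OF this] obtain L M' where
    L: "simple_linear k d L" "tiled k (D - {#d#}) M'" "L \<inter> M' = {}" "M = L \<union> M'" .
  then obtain b P where bP: "b \<in> vecs k" "\<forall>j<d. P j \<in> vecs k" "inj_on (lin b P d) (vecs d)"
    "L = lin b P d ` vecs d"
    by (auto simp: simple_linear_def)
  have refine: "tiled k (E + (D - {#d#})) M" if "tiled d E (vecs d)" for E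
    using tiled_Un[OF tiled_lin_image[OF that bP(3,1)] L(2)] bP(2,4) L(3,4) by simp
  show "tiled k (add_mset d D) M"
    using refine[OF tiled_vecs_split_parity[of n, folded n]] assms(2) by simp
  have "add_mset n (add_mset d (D - {#d#})) = add_mset (d - 1) D" using assms(2) n by simp
  then show "tiled k (add_mset (d - 1) D) M"
    using refine[OF tiled_vecs_split_zero[of n, folded n]] by (simp add: add_mset_commute)
qed

text \<open>A tile of dimension \<open>l\<close> splits off one of dimension \<open>l - 1\<close>,
  this one a tile of dimension \<open>l - 2\<close>, and so on down to 0. Afterwards every dimension
  up to \<open>l\<close> is present.\<close>

lemma tiled_fill_below:
  assumes "tiled k D M" "l \<in># D"
  shows "tiled k (D + mset [0..<l]) M"
proof -
  have "tiled k (D + mset [j..<l]) M" if "j \<le> l" for j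
    using that
  proof (induction rule: inc_induct)
    case base
    then show ?case using assms(1) by simp
  next
    case (step j)
    have "Suc j \<in># D + mset [Suc j..<l]" using step.hyps assms(2) by (cases "Suc j = l") auto
    from tiled_split(2)[OF step.IH this] show ?case
      using step.hyps by (simp add: upt_conv_Cons)
  qed
  then show ?thesis by simp
qed

text \<open>A tile of dimension \<open>i > 0\<close> is doubled by the parity move. A point cannot
  be doubled; it is split off from a tile of dimension 1, which exists because
  \<open>l > 0\<close>.\<close>

lemma tiled_add_rest:
  assumes "tiled k C M" "\<forall>i\<le>l. i \<in># C" "l > 0" "\<forall>i\<in>#E. i \<le> l"
  shows "tiled k (C + E) M"
  using assms(4)
proof (induction E)
  case empty
  then show ?case using assms(1) by simp
next
  case (add i E)
  then have *: "tiled k (C + E) M" "i \<le> l" by auto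
  show ?case
  proof (cases "i = 0")
    case True
    have "1 \<in># C + E" using assms(2,3) by simp
    from tiled_split(2)[OF *(1) this] show ?thesis using True by simp
  next
    case False
    have "i \<in># C + E" using assms(2) *(2) by simp
    from tiled_split(1)[OF *(1) this] show ?thesis using False by simp
  qed
qed

section \<open>Semilinear graphs, growth and uniqueness\<close>

text \<open>In contrast to \<open>tiled\<close>, pieces may overlap and representations may repeat.
  Both the definability of graphs and the growth bound start from this form.\<close>

inductive semilinear :: "nat \<Rightarrow> (nat \<Rightarrow> nat) set \<Rightarrow> bool" for k where
  semilinear_empty: "semilinear k {}"
| semilinear_insert: "semilinear k S \<Longrightarrow> b \<in> vecs k \<Longrightarrow> \<forall>j<d. P j \<in> vecs k \<Longrightarrow>
    semilinear k (lin b P d ` vecs d \<union> S)"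

lemma tiled_semilinear: "tiled k D M \<Longrightarrow> semilinear k M"
  by (induction rule: tiled.induct) (auto simp: simple_linear_def intro: semilinear.intros)

text \<open>The counterpart of list concatenation under \<open>assign\<close>.\<close>

definition join :: "nat \<Rightarrow> (nat \<Rightarrow> nat) \<Rightarrow> (nat \<Rightarrow> nat) \<Rightarrow> nat \<Rightarrow> nat" where
  "join k x y = (\<lambda>i. if i < k then x i else y (i - k))"

lemma join_in_vecs: "y \<in> vecs l \<Longrightarrow> join k x y \<in> vecs (k + l)"
  by (auto simp: join_def vecs_def)

lemma join_lin:
  "join k (lin b P d c) (lin b' P' d c) = lin (join k b b') (\<lambda>j. join k (P j) (P' j)) d c"
  by (auto simp: join_def lin_def)

text \<open>Tiles of equal dimension are matched by keeping the coefficient vector \<open>c\<close>.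
  The graph of such a matching is again a linear set, with base points and periods joined.\<close>

lemma common_tiling_bij:
  assumes "tiled k D M" "tiled l D N"
  shows "\<exists>F. bij_betw F M N \<and> semilinear (k + l) ((\<lambda>x. join k x (F x)) ` M)"
  using assms
proof (induction arbitrary: N rule: tiled.induct)
  case tiled_empty
  then have "N = {}" by cases auto
  then show ?case by (auto simp: bij_betw_def intro: semilinear_empty)
next
  case (tiled_insert D M d L)
  from tiled_remove[OF tiled_insert.prems] obtain L' N' where
    N: "simple_linear l d L'" "tiled l D N'" "L' \<inter> N' = {}" "N = L' \<union> N'" .
  from tiled_insert.IH[OF N(2)] obtain F where
    F: "bij_betw F M N'" "semilinear (k + l) ((\<lambda>x. join k x (F x)) ` M)"
    by blast
  from tiled_insert.hyps(2) obtain b P where P: "b \<in> vecs k" "\<forall>j<d. P j \<in> vecs k"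
    "inj_on (lin b P d) (vecs d)" "L = lin b P d ` vecs d"
    unfolding simple_linear_def by blast
  from N(1) obtain b' P' where P': "b' \<in> vecs l" "\<forall>j<d. P' j \<in> vecs l"
    "inj_on (lin b' P' d) (vecs d)" "L' = lin b' P' d ` vecs d"
    unfolding simple_linear_def by blast
  define G where "G = lin b' P' d \<circ> the_inv_into (vecs d) (lin b P d)"
  have G: "G (lin b P d c) = lin b' P' d c" if "c \<in> vecs d" for c
    using that P(3) by (simp add: G_def the_inv_into_f_f)
  have "bij_betw (lin b P d) (vecs d) L" "bij_betw (lin b' P' d) (vecs d) L'"
    using P P' by (auto simp: bij_betw_def)
  then have GL: "bij_betw G L L'"
    unfolding G_def by (intro bij_betw_trans[OF bij_betw_the_inv_into])
  define H where "H x = (if x \<in> L then G x else F x)" for x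
  have HL: "H x = G x" if "x \<in> L" for x using that by (simp add: H_def)
  have HM: "H x = F x" if "x \<in> M" for x
    using that tiled_insert.hyps(3) by (auto simp: H_def)
  have "bij_betw H L L'" using GL HL by (simp cong: bij_betw_cong)
  moreover have "bij_betw H M N'" using F(1) HM by (simp cong: bij_betw_cong)
  ultimately have bij: "bij_betw H (L \<union> M) N"
    unfolding N(4) using N(3) by (rule bij_betw_combine)
  have "(\<lambda>x. join k x (H x)) ` L = lin (join k b b') (\<lambda>j. join k (P j) (P' j)) d ` vecs d"
    unfolding P(4) image_image
    by (rule image_cong) (simp_all add: G HL P(4) flip: join_lin)
  moreover have "(\<lambda>x. join k x (H x)) ` M = (\<lambda>x. join k x (F x)) ` M"
    by (rule image_cong) (simp_all add: HM)
  ultimately have "semilinear (k + l) ((\<lambda>x. join k x (H x)) ` (L \<union> M))"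
    unfolding image_Un using F(2) P'(1,2) by (auto intro!: semilinear_insert join_in_vecs)
  then show ?case using bij by blast
qed

section \<open>Formulas defining semilinear sets\<close>

primrec exs :: "nat \<Rightarrow> nat \<Rightarrow> fm \<Rightarrow> fm" where
  "exs n 0 p = p"
| "exs n (Suc m) p = Exists (n + m) (exs n m p)"

primrec conjs :: "(nat \<Rightarrow> fm) \<Rightarrow> fm \<Rightarrow> nat \<Rightarrow> fm" where
  "conjs f p 0 = p"
| "conjs f p (Suc m) = Conj (f m) (conjs f p m)"

text \<open>As the language has no constants, the empty sum is a variable \<open>z\<close> that the
  formula forces to be 0.\<close>

primrec smult_tm :: "nat \<Rightarrow> nat \<Rightarrow> nat \<Rightarrow> tm" where
  "smult_tm z 0 x = Var z"
| "smult_tm z (Suc m) x = Plus (Var x) (smult_tm z m x)"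

primrec sum_tm :: "(nat \<Rightarrow> tm) \<Rightarrow> tm \<Rightarrow> nat \<Rightarrow> tm" where
  "sum_tm f t 0 = t"
| "sum_tm f t (Suc m) = Plus (f m) (sum_tm f t m)"

definition zero_fm :: "nat \<Rightarrow> fm" where
  "zero_fm x = Eq (Plus (Var x) (Var x)) (Var x)"

text \<open>1 is the only nonzero number that is not a sum of two nonzero numbers.\<close>

definition one_fm :: "nat \<Rightarrow> nat \<Rightarrow> nat \<Rightarrow> fm" where
  "one_fm x u v = Conj (Neg (zero_fm x))
     (Neg (Exists u (Exists v (Conj (Neg (zero_fm u)) (Conj (Neg (zero_fm v))
       (Eq (Plus (Var u) (Var v)) (Var x)))))))"

lemma sat_exs: "sat e (exs n m p) \<longleftrightarrow> (\<exists>c. sat (\<lambda>i. if n \<le> i \<and> i < n + m then c i else e i) p)"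
proof (induction m arbitrary: e)
  case 0
  have "(\<lambda>i. if n \<le> i \<and> i < n + 0 then c i else e i) = e" for c by auto
  then show ?case by (simp only: exs.simps) simp
next
  case (Suc m)
  have upd: "(\<lambda>i. if n \<le> i \<and> i < n + m then c i else (e(n + m := a)) i) =
    (\<lambda>i. if n \<le> i \<and> i < n + Suc m then (c(n + m := a)) i else e i)" for c a
    by (rule ext) auto
  have "sat e (exs n (Suc m) p) \<longleftrightarrow>
      (\<exists>a c. sat (\<lambda>i. if n \<le> i \<and> i < n + Suc m then (c(n + m := a)) i else e i) p)"
    by (simp only: exs.simps sat.simps Suc.IH upd)
  also have "\<dots> \<longleftrightarrow> (\<exists>c. sat (\<lambda>i. if n \<le> i \<and> i < n + Suc m then c i else e i) p)"
  proof
    assume "\<exists>c. sat (\<lambda>i. if n \<le> i \<and> i < n + Suc m then c i else e i) p"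
    then obtain c where
      "sat (\<lambda>i. if n \<le> i \<and> i < n + Suc m then (c(n + m := c (n + m))) i else e i) p"
      unfolding fun_upd_triv ..
    then show "\<exists>a c. sat (\<lambda>i. if n \<le> i \<and> i < n + Suc m then (c(n + m := a)) i else e i) p"
      by blast
  qed blast
  finally show ?case .
qed

lemma free_vars_exs: "free_vars (exs n m p) = free_vars p - {n..<n + m}"
proof (induction m)
  case (Suc m)
  have "{n..<n + Suc m} = insert (n + m) {n..<n + m}" by auto
  then show ?case by (simp only: exs.simps free_vars.simps Suc.IH Diff_insert[symmetric])
qed simp

lemma sat_conjs: "sat e (conjs f p m) \<longleftrightarrow> sat e p \<and> (\<forall>i<m. sat e (f i))"
  by (induction m) (auto simp: less_Suc_eq)

lemma free_vars_conjs: "free_vars (conjs f p m) = free_vars p \<union> (\<Union>i<m. free_vars (f i))"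
  by (induction m) (auto simp: less_Suc_eq)

lemma tm_val_smult: "e z = 0 \<Longrightarrow> tm_val e (smult_tm z m x) = m * e x"
  by (induction m) auto

lemma tm_vars_smult: "tm_vars (smult_tm z m x) \<subseteq> {z, x}"
  by (induction m) auto

lemma tm_val_sum: "tm_val e (sum_tm f t m) = tm_val e t + (\<Sum>j<m. tm_val e (f j))"
  by (induction m) auto

lemma tm_vars_sum: "tm_vars (sum_tm f t m) = tm_vars t \<union> (\<Union>j<m. tm_vars (f j))"
  by (induction m) (auto simp: less_Suc_eq)

lemma sat_one_fm:
  assumes "x \<noteq> u" "x \<noteq> v" "u \<noteq> v"
  shows "sat e (one_fm x u v) \<longleftrightarrow> e x = 1"
proof -
  have "sat e (one_fm x u v) \<longleftrightarrow> e x \<noteq> 0 \<and> \<not> (\<exists>a b. a \<noteq> 0 \<and> b \<noteq> 0 \<and> a + b = e x)"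
    using assms by (simp add: one_fm_def zero_fm_def)
  also have "\<dots> \<longleftrightarrow> e x = 1"
  proof
    assume *: "e x \<noteq> 0 \<and> \<not> (\<exists>a b. a \<noteq> 0 \<and> b \<noteq> 0 \<and> a + b = e x)"
    show "e x = 1"
    proof (rule ccontr)
      assume "e x \<noteq> 1"
      then have "1 \<noteq> (0::nat) \<and> e x - 1 \<noteq> 0 \<and> 1 + (e x - 1) = e x" using * by linarith
      then show False using * by blast
    qed
  qed auto
  finally show ?thesis .
qed

lemma definable_empty: "definable n {}"
  unfolding definable_def
  by (intro exI[of _ "Exists 0 (Neg (Eq (Var 0) (Var 0)))"]) auto

lemma definable_Un:
  assumes "definable n A" "definable n B"
  shows "definable n (A \<union> B)"
proof -
  obtain p q where "free_vars p \<subseteq> {..<n}" "A = {xs \<in> tuples n. sat (assign xs) p}"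
    "free_vars q \<subseteq> {..<n}" "B = {xs \<in> tuples n. sat (assign xs) q}"
    using assms unfolding definable_def by blast
  then show ?thesis
    unfolding definable_def by (intro exI[of _ "Neg (Conj (Neg p) (Neg q))"]) auto
qed

lemma definable_linear:
  assumes "b \<in> vecs n" "\<forall>j<d. P j \<in> vecs n"
  shows "definable n {xs \<in> tuples n. assign xs \<in> lin b P d ` vecs d}"
proof -
  \<comment> \<open>Layout of the variables: below \<open>n\<close> the coordinates, at
    \<open>n\<close> the number 0, at \<open>n + 1\<close> the number 1, from \<open>n + 2\<close>
    on the \<open>d\<close> coefficients. The two after these are bound inside
    \<open>one_fm\<close>. The base point enters as a multiple of the variable for 1.\<close>
  define eq where "eq i = Eq (Var i) (sum_tm (\<lambda>j. smult_tm n (P j i) (n + 2 + j))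
    (smult_tm n (b i) (n + 1)) d)" for i
  define body where "body = conjs eq (Conj (zero_fm n) (one_fm (n + 1) (n + d + 2) (n + d + 3))) n"
  have vars_eq: "free_vars (eq i) \<subseteq> {..<n + (d + 2)}" if "i < n" for i
    using that tm_vars_smult[of n "b i" "n + 1"] tm_vars_smult[of n "P j i" "n + 2 + j" for j]
    by (fastforce simp: eq_def tm_vars_sum)
  have "free_vars (Conj (zero_fm n) (one_fm (n + 1) (n + d + 2) (n + d + 3))) \<subseteq> {..<n + (d + 2)}"
    by (auto simp: zero_fm_def one_fm_def)
  then have "free_vars body \<subseteq> {..<n + (d + 2)}"
    using vars_eq unfolding body_def free_vars_conjs by blast
  then have free: "free_vars (exs n (d + 2) body) \<subseteq> {..<n}"
    unfolding free_vars_exs by auto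
  have sat_body: "sat e body \<longleftrightarrow> e n = 0 \<and> e (n + 1) = 1 \<and>
      (\<forall>i<n. e i = b i + (\<Sum>j<d. e (n + 2 + j) * P j i))" for e
  proof -
    have "sat e (eq i) \<longleftrightarrow> e i = b i + (\<Sum>j<d. e (n + 2 + j) * P j i)" if "e n = 0" "e (n + 1) = 1" for i
      using that by (simp add: eq_def tm_val_sum tm_val_smult mult.commute)
    moreover have "sat e (zero_fm n) \<longleftrightarrow> e n = 0" by (simp add: zero_fm_def)
    moreover have "sat e (one_fm (n + 1) (n + d + 2) (n + d + 3)) \<longleftrightarrow> e (n + 1) = 1"
      by (rule sat_one_fm) auto
    ultimately show ?thesis unfolding body_def sat_conjs by auto
  qed
  have "sat e (exs n (d + 2) body) \<longleftrightarrow> e \<in> lin b P d ` vecs d" if e: "e \<in> vecs n" for e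
  proof
    assume "sat e (exs n (d + 2) body)"
    then obtain c where c: "sat (\<lambda>i. if n \<le> i \<and> i < n + (d + 2) then c i else e i) body"
      unfolding sat_exs by blast
    \<comment> \<open>Cutting off at \<open>d\<close> puts the witness into \<open>vecs d\<close>
      without changing the sum.\<close>
    define c' where "c' j = (if j < d then c (n + 2 + j) else 0)" for j
    have "e i = lin b P d c' i" for i
    proof (cases "i < n")
      case True
      then show ?thesis using c unfolding sat_body by (simp add: lin_def c'_def)
    next
      case False
      then show ?thesis using e assms by (simp add: lin_def vecs_def)
    qed
    then have "e = lin b P d c'" by blast
    moreover have "c' \<in> vecs d" by (simp add: c'_def vecs_def)
    ultimately show "e \<in> lin b P d ` vecs d" by blast
  next
    assume "e \<in> lin b P d ` vecs d"
    then obtain c where c: "e = lin b P d c" by blast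
    define c' where "c' i = (if i = n then 0 else if i = n + 1 then 1 else c (i - n - 2))" for i
    have "sat (\<lambda>i. if n \<le> i \<and> i < n + (d + 2) then c' i else e i) body"
      unfolding sat_body by (auto simp: c'_def c lin_def)
    then show "sat e (exs n (d + 2) body)" unfolding sat_exs by blast
  qed
  moreover have "assign xs \<in> vecs n" if "xs \<in> tuples n" for xs
    using that by (auto simp: assign_def vecs_def tuples_def)
  ultimately have "{xs \<in> tuples n. assign xs \<in> lin b P d ` vecs d} =
      {xs \<in> tuples n. sat (assign xs) (exs n (d + 2) body)}"
    by blast
  then show ?thesis using free unfolding definable_def by blast
qed

lemma semilinear_definable:
  "semilinear n S \<Longrightarrow> definable n {xs \<in> tuples n. assign xs \<in> S}"
proof (induction rule: semilinear.induct)
  case semilinear_empty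
  then show ?case using definable_empty by simp
next
  case (semilinear_insert S b d P)
  have "{xs \<in> tuples n. assign xs \<in> lin b P d ` vecs d \<union> S} =
    {xs \<in> tuples n. assign xs \<in> lin b P d ` vecs d} \<union> {xs \<in> tuples n. assign xs \<in> S}" by blast
  then show ?case using definable_Un definable_linear semilinear_insert by simp
qed

section \<open>Transfer between lists and zero-padded functions\<close>

lemma inj_on_assign: "inj_on assign (tuples k)"
  by (rule inj_onI) (auto simp: tuples_def assign_def fun_eq_iff intro!: nth_equalityI, metis)

lemma assign_append: "xs \<in> tuples k \<Longrightarrow> assign (xs @ ys) = join k (assign xs) (assign ys)"
  by (auto simp: assign_def join_def tuples_def nth_append fun_eq_iff)

lemma bij_betw_vecs_tuples: "bij_betw (\<lambda>e. map e [0..<l]) (vecs l) (tuples l)"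
proof (rule bij_betw_byWitness[where f' = assign])
  show "\<forall>e\<in>vecs l. assign (map e [0..<l]) = e"
    by (auto simp: assign_def vecs_def fun_eq_iff)
  show "\<forall>xs\<in>tuples l. map (assign xs) [0..<l] = xs"
    by (auto simp: assign_def tuples_def intro!: nth_equalityI)
qed (auto simp: assign_def vecs_def tuples_def)

lemma tiled_definable_bij:
  assumes "M \<subseteq> tuples k" "tiled k D (assign ` M)" "tiled l D (vecs l)"
  shows "\<exists>f. definable_bij k l f M"
proof -
  from common_tiling_bij[OF assms(2,3)] obtain F where
    F: "bij_betw F (assign ` M) (vecs l)"
      "semilinear (k + l) ((\<lambda>x. join k x (F x)) ` assign ` M)"
    by blast
  define f where "f xs = map (F (assign xs)) [0..<l]" for xs
  have "bij_betw assign M (assign ` M)"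
    using inj_on_subset[OF inj_on_assign assms(1)] by (simp add: bij_betw_def)
  from bij_betw_trans[OF bij_betw_trans[OF this F(1)] bij_betw_vecs_tuples]
  have bij: "bij_betw f M (tuples l)" by (simp add: f_def[abs_def] comp_def)
  have assign_f: "assign (xs @ f xs) = join k (assign xs) (F (assign xs))" if "xs \<in> M" for xs
  proof -
    have "F (assign xs) \<in> vecs l" using bij_betw_apply[OF F(1)] that by blast
    then have "assign (f xs) = F (assign xs)"
      by (auto simp: f_def assign_def vecs_def fun_eq_iff)
    then show ?thesis using assign_append[of xs k] that assms(1) by auto
  qed
  have graph: "graph_on M f \<subseteq> tuples (k + l)"
    using assms(1) bij_betw_apply[OF bij] by (fastforce simp: graph_on_def tuples_def)
  have img: "assign ` graph_on M f = (\<lambda>x. join k x (F x)) ` assign ` M"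
    unfolding graph_on_def image_image using assign_f by (rule image_cong[OF refl])
  \<comment> \<open>Injectivity of \<open>assign\<close> on tuples recovers the graph from its
    image, which is known to be semilinear.\<close>
  have "graph_on M f = {zs \<in> tuples (k + l). assign zs \<in> assign ` graph_on M f}"
    using graph inj_on_image_mem_iff[OF inj_on_assign _ graph] by blast
  then have "definable (k + l) (graph_on M f)"
    unfolding img using semilinear_definable[OF F(2)] by simp
  then show ?thesis using bij unfolding definable_bij_def by blast
qed

text \<open>A period that vanishes on \<open>J\<close> must vanish on \<open>I\<close>, since the base point and its translate by
  this period agree on \<open>J\<close>.\<close>
lemma semilinear_growth:
  fixes I J :: "nat set"
  assumes "semilinear n S"
    and "\<forall>u\<in>S. \<forall>v\<in>S. (\<forall>j\<in>J. u j = v j) \<longrightarrow> (\<forall>i\<in>I. u i = v i)" and "finite I" "finite J"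
  shows "\<exists>C. \<forall>u\<in>S. (\<Sum>i\<in>I. u i) \<le> C * ((\<Sum>j\<in>J. u j) + 1)"
  using assms(1,2)
proof (induction rule: semilinear.induct)
  case (semilinear_insert S b d P)
  then obtain C where C: "\<forall>u\<in>S. (\<Sum>i\<in>I. u i) \<le> C * ((\<Sum>j\<in>J. u j) + 1)" by auto
  \<comment> \<open>\<open>K\<close> bounds the \<open>I\<close>-sum of each period. A period not
    vanishing on \<open>J\<close> has \<open>J\<close>-sum at least 1, so \<open>K\<close> times
    that sum suffices.\<close>
  define K where "K = (\<Sum>m<d. \<Sum>i\<in>I. P m i)"
  have sum_lin: "(\<Sum>i\<in>A. lin b P d c i) = (\<Sum>i\<in>A. b i) + (\<Sum>m<d. c m * (\<Sum>i\<in>A. P m i))"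
    for A :: "nat set" and c
    unfolding lin_def sum.distrib sum_distrib_left by (simp add: sum.swap[of _ A])
  have per: "(\<Sum>i\<in>I. P m i) \<le> K * (\<Sum>j\<in>J. P m j)" if "m < d" for m
  proof (cases "\<forall>j\<in>J. P m j = 0")
    case True
    let ?u = "\<lambda>i. if i = m then 1 else 0 :: nat"
    have 1: "b \<in> lin b P d ` vecs d"
      by (rule image_eqI[of _ _ "\<lambda>_. 0"]) (simp_all add: lin_def)
    have 2: "(\<lambda>i. b i + P m i) \<in> lin b P d ` vecs d"
      using that by (intro image_eqI[of _ _ ?u])
        (simp_all add: lin_def vecs_def if_distrib[of "\<lambda>x. x * _"] cong: if_cong)
    from semilinear_insert.prems[THEN bspec, THEN bspec, OF UnI1[OF 1] UnI1[OF 2]]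
    have "\<forall>i\<in>I. b i = b i + P m i" using True by simp
    then show ?thesis by simp
  next
    case False
    then have "(\<Sum>j\<in>J. P m j) \<noteq> 0" using assms(4) by simp
    then have "1 \<le> (\<Sum>j\<in>J. P m j)" by linarith
    moreover have "(\<Sum>i\<in>I. P m i) \<le> K"
      unfolding K_def using that by (intro member_le_sum) auto
    ultimately show ?thesis using mult_le_mono[of _ K 1] by simp
  qed
  have bound: "(\<Sum>i\<in>I. lin b P d c i) \<le> ((\<Sum>i\<in>I. b i) + K) * ((\<Sum>j\<in>J. lin b P d c j) + 1)" for c
  proof -
    have "(\<Sum>m<d. c m * (\<Sum>i\<in>I. P m i)) \<le> (\<Sum>m<d. c m * (K * (\<Sum>j\<in>J. P m j)))"
      using per by (intro sum_mono mult_left_mono) auto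
    also have "\<dots> = K * (\<Sum>m<d. c m * (\<Sum>j\<in>J. P m j))"
      by (simp add: sum_distrib_left mult.left_commute)
    also have "\<dots> \<le> K * (\<Sum>j\<in>J. lin b P d c j)" unfolding sum_lin[of _ J] by simp
    finally show ?thesis unfolding sum_lin[of _ I] by (simp add: algebra_simps)
  qed
  show ?case
  proof (intro exI ballI)
    fix u assume u: "u \<in> lin b P d ` vecs d \<union> S"
    have "(\<Sum>i\<in>I. u i) \<le> C * ((\<Sum>j\<in>J. u j) + 1) \<or>
        (\<Sum>i\<in>I. u i) \<le> ((\<Sum>i\<in>I. b i) + K) * ((\<Sum>j\<in>J. u j) + 1)"
      using u C bound by blast
    then show "(\<Sum>i\<in>I. u i) \<le> (C + ((\<Sum>i\<in>I. b i) + K)) * ((\<Sum>j\<in>J. u j) + 1)"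
      unfolding add_mult_distrib[of C] by linarith
  qed
qed auto

section \<open>Linear growth and dimension\<close>

lemma sum_list_assign: "xs \<in> tuples k \<Longrightarrow> sum_list xs = (\<Sum>i<k. assign xs i)"
  by (auto simp: sum_list_sum_nth assign_def tuples_def lessThan_atLeast0 intro: sum.cong)

text \<open>The graph is definable, hence semilinear. Its first \<open>k\<close> coordinates
  determine the last \<open>l\<close> because \<open>f\<close> is a map, and conversely because
  \<open>f\<close> is injective; the growth bound therefore applies in both directions.\<close>

lemma definable_bij_growth:
  assumes "M \<subseteq> tuples k" "definable_bij k l f M"
  shows "\<exists>C. \<forall>xs\<in>M. sum_list (f xs) \<le> C * (sum_list xs + 1) \<and> sum_list xs \<le> C * (sum_list (f xs) + 1)"
proof -
  have bij: "bij_betw f M (tuples l)" and def: "definable (k + l) (graph_on M f)"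
    using assms(2) by (auto simp: definable_bij_def)
  have f_in: "f xs \<in> tuples l" if "xs \<in> M" for xs using bij_betw_apply[OF bij that] .
  obtain D where "tiled (k + l) D (assign ` graph_on M f)" using definable_tiled[OF def] ..
  then have S: "semilinear (k + l) (assign ` graph_on M f)" by (rule tiled_semilinear)
  define w where "w xs = join k (assign xs) (assign (f xs))" for xs
  have graph: "assign ` graph_on M f = w ` M"
    unfolding graph_on_def image_image w_def
    using assign_append assms(1) by (intro image_cong) auto
  have w1: "(\<Sum>i<k. w xs i) = sum_list xs" if "xs \<in> M" for xs
    using that assms(1) by (subst sum_list_assign[of _ k]) (auto simp: w_def join_def)
  have w2: "(\<Sum>i\<in>{k..<k + l}. w xs i) = sum_list (f xs)" if "xs \<in> M" for xs
    using sum_list_assign[OF f_in[OF that]] sum.shift_bounds_nat_ivl[of "w xs" 0 k l]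
    by (simp add: w_def join_def add.commute lessThan_atLeast0)
  have inj1: "xs = ys" if "xs \<in> M" "ys \<in> M" "\<forall>i\<in>{..<k}. w xs i = w ys i" for xs ys
    using that assms(1) by (auto simp: w_def join_def tuples_def assign_def subset_iff intro!: nth_equalityI)
  have inj2: "xs = ys" if "xs \<in> M" "ys \<in> M" "\<forall>i\<in>{k..<k + l}. w xs i = w ys i" for xs ys
  proof -
    have "assign (f xs) i = assign (f ys) i" if "i < l" for i
      using \<open>\<forall>i\<in>{k..<k + l}. w xs i = w ys i\<close>[rule_format, of "k + i"] that
      by (simp add: w_def join_def)
    then have "f xs = f ys"
      using f_in[OF that(1)] f_in[OF that(2)]
      by (auto simp: tuples_def assign_def intro!: nth_equalityI)
    then show ?thesis using bij that by (auto simp: bij_betw_def inj_on_def)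
  qed
  have "\<exists>C. \<forall>u\<in>w ` M. (\<Sum>i\<in>{k..<k + l}. u i) \<le> C * ((\<Sum>i<k. u i) + 1)"
    using inj1 by (intro semilinear_growth[OF S[unfolded graph]]) (blast, auto)
  then obtain C1 where C1: "\<forall>xs\<in>M. sum_list (f xs) \<le> C1 * (sum_list xs + 1)"
    using w1 w2 by auto
  have "\<exists>C. \<forall>u\<in>w ` M. (\<Sum>i<k. u i) \<le> C * ((\<Sum>i\<in>{k..<k + l}. u i) + 1)"
    using inj2 by (intro semilinear_growth[OF S[unfolded graph]]) (blast, auto)
  then obtain C2 where C2: "\<forall>xs\<in>M. sum_list xs \<le> C2 * (sum_list (f xs) + 1)"
    using w1 w2 by auto
  show ?thesis
  proof (intro exI ballI conjI)
    fix xs assume "xs \<in> M"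
    then have "sum_list (f xs) \<le> C1 * (sum_list xs + 1)" "sum_list xs \<le> C2 * (sum_list (f xs) + 1)"
      using C1 C2 by blast+
    then show "sum_list (f xs) \<le> (C1 + C2) * (sum_list xs + 1)"
      "sum_list xs \<le> (C1 + C2) * (sum_list (f xs) + 1)"
      unfolding add_mult_distrib[of C1] by linarith+
  qed
qed

text \<open>Counting: a box of side \<open>t\<close> with \<open>t ^ l\<close> points is mapped
  injectively into a box of side \<open>K * t\<close> with \<open>(K * t) ^ m\<close> points. For
  \<open>l > m\<close> this forces \<open>t \<le> K ^ m\<close>.\<close>

lemma linear_growth_injection_dim:
  assumes inj: "inj_on h (tuples l)" and h: "\<And>ys. ys \<in> tuples l \<Longrightarrow> h ys \<in> tuples m"
    and growth: "\<And>ys. ys \<in> tuples l \<Longrightarrow> sum_list (h ys) \<le> C * (sum_list ys + 1)"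
  shows "l \<le> m"
proof (rule ccontr)
  assume "\<not> l \<le> m"
  \<comment> \<open>Chosen so that \<open>C * (l * t + 1) < K * t\<close> for
    \<open>t \<ge> 1\<close>; the value of \<open>t\<close> just exceeds
    \<open>K ^ m\<close>.\<close>
  define K where "K = C * (l + 1) + 1"
  define t where "t = K ^ m + 1"
  let ?X = "{xs. set xs \<subseteq> {..<t} \<and> length xs = l}"
  let ?Y = "{ys. set ys \<subseteq> {..<K * t} \<and> length ys = m}"
  have sub: "?X \<subseteq> tuples l" by (auto simp: tuples_def)
  have "h ` ?X \<subseteq> ?Y"
  proof
    fix ys assume "ys \<in> h ` ?X"
    then obtain xs where xs: "xs \<in> ?X" "ys = h xs" by blast
    have "sum_list xs \<le> l * t"
      using xs(1) sum_list_mono[of xs "\<lambda>x. x" "\<lambda>_. t"]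
      by (force simp: sum_list_triv)
    then have "sum_list ys \<le> C * (l * t + 1)"
      using growth[of xs] xs sub by (meson add_le_mono1 le_trans mult_le_mono2 subsetD)
    also have "\<dots> < K * t" by (simp add: K_def t_def algebra_simps)
    finally have "sum_list ys < K * t" .
    then have "y < K * t" if "y \<in> set ys" for y
      using member_le_sum_list[of y ys] that by simp
    then show "ys \<in> ?Y" using h[of xs] xs sub by (auto simp: tuples_def)
  qed
  then have "card ?X \<le> card ?Y"
    using inj_on_subset[OF inj sub] by (intro card_inj_on_le) (auto intro: finite_lists_length_eq)
  then have "t ^ l \<le> (K * t) ^ m" by (simp add: card_lists_length_eq)
  moreover have "t ^ Suc m \<le> t ^ l"
    using \<open>\<not> l \<le> m\<close> by (intro power_increasing) (auto simp: t_def)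
  ultimately have "t ^ Suc m \<le> (K * t) ^ m" by simp
  then have "t * t ^ m \<le> K ^ m * t ^ m" by (simp only: power_Suc power_mult_distrib)
  then show False by (simp add: t_def)
qed

text \<open>The composition of \<open>g\<close> with the inverse of \<open>f\<close> is an injection
  of linear growth. With \<open>g\<close> another definable bijection this gives uniqueness, with
  the identity the bound by \<open>k\<close>.\<close>

lemma definable_bij_dim_le:
  assumes "M \<subseteq> tuples k" "definable_bij k l f M"
    and g: "inj_on g M" "\<And>xs. xs \<in> M \<Longrightarrow> g xs \<in> tuples m"
      "\<And>xs. xs \<in> M \<Longrightarrow> sum_list (g xs) \<le> C * (sum_list xs + 1)"
  shows "l \<le> m"
proof -
  have bij: "bij_betw f M (tuples l)" using assms(2) by (simp add: definable_bij_def)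
  obtain C' where C': "\<And>xs. xs \<in> M \<Longrightarrow> sum_list xs \<le> C' * (sum_list (f xs) + 1)"
    using definable_bij_growth[OF assms(1,2)] by blast
  define f' where "f' = the_inv_into M f"
  have f': "bij_betw f' (tuples l) M" unfolding f'_def by (rule bij_betw_the_inv_into[OF bij])
  have f_f': "f (f' ys) = ys" if "ys \<in> tuples l" for ys
    using that bij by (simp add: f'_def bij_betw_def f_the_inv_into_f)
  show ?thesis
  proof (rule linear_growth_injection_dim)
    show "inj_on (g \<circ> f') (tuples l)"
      using f' g(1) by (intro comp_inj_on) (auto simp: bij_betw_def)
    fix ys assume ys: "ys \<in> tuples l"
    then have M: "f' ys \<in> M" using bij_betw_apply[OF f'] by blast
    show "(g \<circ> f') ys \<in> tuples m" using g(2)[OF M] by simp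
    have "sum_list (g (f' ys)) \<le> C * (sum_list (f' ys) + 1)" using g(3)[OF M] .
    also have "\<dots> \<le> C * (C' * (sum_list ys + 1) + 1)"
      using C'[OF M] f_f'[OF ys] by simp
    also have "\<dots> \<le> (C * (C' + 1)) * (sum_list ys + 1)" by (simp add: algebra_simps)
    finally show "sum_list ((g \<circ> f') ys) \<le> (C * (C' + 1)) * (sum_list ys + 1)" by simp
  qed
qed

text \<open>Tiles of dimension 0 are single points; consequently an infinite set has a tile of
  positive dimension.\<close>

lemma tiled_zero_finite: "tiled k D M \<Longrightarrow> \<forall>d\<in>#D. d = 0 \<Longrightarrow> finite M"
proof (induction rule: tiled.induct)
  case (tiled_insert D M d L)
  have "vecs 0 = {\<lambda>_. 0}" by (auto simp: vecs_def)
  then have "finite L" using tiled_insert by (auto simp: simple_linear_def)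
  then show ?case using tiled_insert by simp
qed simp

theorem theorem8:
  fixes k :: nat and M :: "nat list set"
  assumes "k \<ge> 1"
    and "M \<subseteq> tuples k"
    and "infinite M"
    and "definable k M"
  shows "(\<exists>!l. \<exists>f. definable_bij k l f M) \<and>
         (\<forall>l. (\<exists>f. definable_bij k l f M) \<longrightarrow> 1 \<le> l \<and> l \<le> k)"
proof -
  obtain D where D: "tiled k D (assign ` M)" using definable_tiled[OF assms(4)] ..
  have "infinite (assign ` M)"
    using assms(2,3) inj_on_assign finite_imageD inj_on_subset by blast
  then obtain d where d: "d \<in># D" "d > 0" using tiled_zero_finite[OF D] by blast
  define l where "l = Max (set_mset D)"
  have l: "l \<in># D" "\<forall>i\<in>#D. i \<le> l"
    unfolding l_def using d(1) by (auto intro!: Max_in)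
  have "l > 0" using d l by fastforce
  \<comment> \<open>The common multiset: from \<open>D\<close> it is reached by filling below
    \<open>l\<close>; from the trivial tiling of \<open>vecs l\<close> by filling below
    \<open>l\<close> and then adding the other members of \<open>D\<close>, all at most
    \<open>l\<close>.\<close>
  let ?E = "D + mset [0..<l]"
  have "tiled l ({#l#} + mset [0..<l]) (vecs l)"
    using tiled_fill_below[OF tiled_vecs] by simp
  then have "tiled l ({#l#} + mset [0..<l] + (D - {#l#})) (vecs l)"
    by (rule tiled_add_rest[where l = l]) (use l \<open>l > 0\<close> in \<open>auto simp: le_less dest: in_diffD\<close>)
  also have "{#l#} + mset [0..<l] + (D - {#l#}) = ?E" using l(1) by simp
  finally have ex: "\<exists>f. definable_bij k l f M"
    using tiled_definable_bij[OF assms(2) tiled_fill_below[OF D l(1)]] by simp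
  \<comment> \<open>Applied in both orders, this yields equality of the two dimensions.\<close>
  have le: "m \<le> m'" if fg: "definable_bij k m f M" "definable_bij k m' g M" for m m' f g
  proof -
    have g: "bij_betw g M (tuples m')" using fg(2) by (simp add: definable_bij_def)
    obtain C where "\<forall>xs\<in>M. sum_list (g xs) \<le> C * (sum_list xs + 1)"
      using definable_bij_growth[OF assms(2) fg(2)] by blast
    then show ?thesis
      using bij_betw_apply[OF g] bij_betw_imp_inj_on[OF g]
      by (intro definable_bij_dim_le[OF assms(2) fg(1), of g m' C]) auto
  qed
  \<comment> \<open>The identity embeds \<open>M\<close> into \<open>tuples k\<close> with growth
    constant 1.\<close>
  have "m \<le> k" if "definable_bij k m f M" for m f
    using assms(2) by (intro definable_bij_dim_le[OF assms(2) that, of id k 1]) auto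
  moreover have "1 \<le> m" if "definable_bij k m f M" for m f
  proof (rule ccontr)
    assume "\<not> 1 \<le> m"
    then have "finite (tuples m)" by (simp add: tuples_def not_le)
    then show False
      using that assms(3) bij_betw_finite[of f M "tuples m"] by (simp add: definable_bij_def)
  qed
  ultimately show ?thesis using ex le by (meson le_antisym)
qed

end
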